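(* Let $\hat{B}:=\{\tilde{\pi}^{e^{*}w(v)}x^{v}: v\in \mathcal{B}\}$. Then (the image of) $\hat{B}$ forms a basis of the $\mathbb{Z}_q[\tilde\pi]$-module $H^n(\Omega^{\bullet}(\mathcal{C}_0,\nabla(D)))=\mathcal{C}_0/\sum_{l=1}^n D_l\mathcal{C}_0$.
   Context: Let $p>2$ be a prime, $q=p^a$ a power of $p$, $n\ge 1$ an integer, $a_1,\dots,a_n,d_1,\dots,d_n$ positive integers not divisible by $p$, and $\bar\lambda\in\mathbb{F}_q^{*}$. Put $$\bar F(\bar\lambda,x)=\sum_{i=1}^n x_i^{a_i}+\bar\lambda\prod_{i=1}^n x_i^{-d_i}.$$ Weight. $\Delta(\bar F)\subset\mathbb{R}^n$ is the convex hull of the origin and the exponent vectors of $\bar F$, i.e. of $0$, $A_j$ ($1\le j\le n$; $A_j$ has $j$-th component $a_j$ and other components $0$) and $\gamma=(-d_1,\dots,-d_n)$. For $v\in\mathbb{Z}^n$, $w(v)$ is the least nonnegative rational number such that $v\in w(v)\Delta(\bar F)$. The integer $e^{*}$. $e^{*}=\mathrm{lcm}(a_1,d_1)$ if $n=1$, and $e^{*}=\mathrm{lcm}(a_1,\dots,a_n)\cdot\mathrm{lcm}(d_1,\dots,d_n)$ if $n\ge2$. One has $w(\mathbb{Z}^n)\subset\frac1{e^{*}}\mathbb{Z}_{\ge0}$. The set $\mathcal{B}$. If $n=1$, $\mathcal{B}=\{v\in\mathbb{Z}:-d_1<v\le a_1\}$. If $n\ge2$, $\mathcal{B}$ is the set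 of $(v_1,\dots,v_n)\in\mathbb{Z}^n$ with $-d_i<v_i\le a_i$ for all $1\le i\le n$ and $$\frac{d_j}{d_i}(v_i-a_i)\le v_j<\frac{d_j}{d_i}v_i+a_j\quad\text{for all }1\le i<j\le n.$$ Coefficient ring. $\mathbb{Q}_q$ is the unramified extension of $\mathbb{Q}_p$ of degree $a$; $\zeta_p$ is a primitive $p$-th root of unity; $\pi$ is an element of an algebraic closure of $\mathbb{Q}_p$ with $\pi^{p-1}=-p$ (so $\mathbb{Q}_p(\pi)=\mathbb{Q}_p(\zeta_p)$); $\tilde\pi$ is an $e^{*}$-th root of $\pi$; $\mathbb{Z}_q[\tilde\pi]$ is the ring of integers of $\mathbb{Q}_q(\zeta_p,\tilde\pi)$. The complex. Let $\lambda$ be the Teichmüller representative of $\bar\lambda$ and $F(\lambda,x)=\sum_{i=1}^n x_i^{a_i}+\lambda\prod_{i=1}^n x_i^{-d_i}$ the Teichmüller lift of $\bar F$. Set $$\mathcal{C}_0=\Big\{\sum_{u\in\mathbb{Z}^n}c_u\tilde\pi^{e^{*}w(u)}x^u:\ c_u\in\mathbb{Z}_q[\tilde\pi],\ c_u\to0\text{ as }u\to\infty\Big\},\qquad D_l=x_l\frac{\partial}{\partial x_l}+\pi x_l\frac{\partial F(\lambda,x)}{\partial x_l}\quad(1\le l\le n).$$ $\Omega^{\bullet}(\mathcal{C}_0,\nabla(D))$ is the Koszul complex with $\Omega^{i}=\bigoplus_{1\le j_1<\dots<j_i\le n}\mathcal{C}_0\frac{dx_{j_1}}{x_{j_1}}\wedge\cdots\wedge\frac{dx_{j_i}}{x_{j_i}}$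 and boundary map $$\nabla(D)\Big(\zeta\frac{dx_{j_1}}{x_{j_1}}\wedge\cdots\wedge\frac{dx_{j_i}}{x_{j_i}}\Big)=\Big(\sum_{l=1}^nD_l(\zeta)\frac{dx_l}{x_l}\Big)\wedge\frac{dx_{j_1}}{x_{j_1}}\wedge\cdots\wedge\frac{dx_{j_i}}{x_{j_i}}.$$ Its top cohomology $H^n$ is identified with $\mathcal{C}_0/\sum_{l=1}^nD_l\mathcal{C}_0$. *)

theory Defs
  imports
    "HOL-Analysis.Analysis"
    "HOL-Computational_Algebra.Polynomial"
    "HOL-Computational_Algebra.Primes"
    "HOL-Library.Function_Algebras"
begin

section \<open>Bases of quotient modules\<close>

text \<open>
  The image of \<open>S\<close> is a basis of the \<open>R\<close>-module \<open>M / N\<close>, where \<open>R\<close> is a subring of the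
  type \<open>'r\<close>, and \<open>N \<subseteq> M\<close> are \<open>R\<close>-submodules of the type \<open>'m\<close> on which \<open>'r\<close> acts by \<open>sc\<close>.
  Vanishing in \<open>M / N\<close> means lying in \<open>N\<close>. The elements of \<open>S\<close> are the index set, so that linear
  independence includes injectivity of \<open>S \<rightarrow> M / N\<close>.
\<close>

definition basis_modulo ::
  "'r::ring_1 set \<Rightarrow> ('r \<Rightarrow> 'm \<Rightarrow> 'm) \<Rightarrow> 'm set \<Rightarrow> 'm set \<Rightarrow> 'm::ab_group_add set \<Rightarrow> bool" where
  "basis_modulo R sc M N S \<longleftrightarrow>
     S \<subseteq> M \<and>
     (\<forall>x\<in>M. \<exists>T c. finite T \<and> T \<subseteq> S \<and> c ` T \<subseteq> R \<and> x - (\<Sum>s\<in>T. sc (c s) s) \<in> N) \<and>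
     (\<forall>T c. finite T \<and> T \<subseteq> S \<and> c ` T \<subseteq> R \<and> (\<Sum>s\<in>T. sc (c s) s) \<in> N \<longrightarrow> (\<forall>s\<in>T. c s = 0))"


section \<open>\<open>p\<close>-adic fields\<close>

definition is_subfield :: "'k::field set \<Rightarrow> bool" where
  "is_subfield K \<longleftrightarrow> 0 \<in> K \<and> 1 \<in> K \<and>
     (\<forall>x\<in>K. \<forall>y\<in>K. x + y \<in> K \<and> x * y \<in> K) \<and> (\<forall>x\<in>K. - x \<in> K \<and> inverse x \<in> K)"

definition field_generated :: "'k::field set \<Rightarrow> 'k set" where
  "field_generated X = \<Inter>{K. is_subfield K \<and> X \<subseteq> K}"

definition is_absolute_value :: "('k::field \<Rightarrow> real) \<Rightarrow> bool" where
  "is_absolute_value abv \<longleftrightarrow>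
     (\<forall>x. 0 \<le> abv x) \<and> (\<forall>x. abv x = 0 \<longleftrightarrow> x = 0) \<and>
     (\<forall>x y. abv (x * y) = abv x * abv y) \<and> (\<forall>x y. abv (x + y) \<le> max (abv x) (abv y))"

definition complete_under :: "('k::field \<Rightarrow> real) \<Rightarrow> 'k set \<Rightarrow> bool" where
  "complete_under abv K \<longleftrightarrow>
     (\<forall>X::nat \<Rightarrow> 'k. (\<forall>i. X i \<in> K) \<and> (\<forall>e>0. \<exists>N. \<forall>i\<ge>N. \<forall>j\<ge>N. abv (X i - X j) < e) \<longrightarrow>
        (\<exists>x\<in>K. (\<lambda>i. abv (X i - x)) \<longlonglongrightarrow> 0))"

definition closure_of_rationals :: "('k::field_char_0 \<Rightarrow> real) \<Rightarrow> 'k set" where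
  "closure_of_rationals abv = {x. \<forall>e>0. \<exists>r::rat. abv (x - of_rat r) < e}"

text \<open>
  The type \<open>'k\<close> is an algebraic closure of \<open>\<rat>\<^sub>p\<close>, and \<open>abv\<close> is the extension to it of the
  \<open>p\<close>-adic absolute value. The field \<open>\<rat>\<^sub>p\<close> is the completion of \<open>\<rat>\<close> at \<open>p\<close>, so within \<open>'k\<close> it
  is the closure of \<open>\<rat>\<close>, provided that this closure is complete. (The value at \<open>p\<close> determines the
  nonarchimedean \<open>abv\<close> on \<open>\<rat>\<close>.) The whole of \<open>'k\<close> is not complete.
\<close>

definition padic_algebraic_closure :: "nat \<Rightarrow> ('k::{alg_closed_field, field_char_0} \<Rightarrow> real) \<Rightarrow> bool" where
  "padic_algebraic_closure p abv \<longleftrightarrow>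
     is_absolute_value abv \<and> abv (of_nat p) = 1 / real p \<and>
     complete_under abv (closure_of_rationals abv) \<and>
     (\<forall>x. \<exists>f. f \<noteq> 0 \<and> (\<forall>i. coeff f i \<in> closure_of_rationals abv) \<and> poly f x = 0)"

definition integers_of :: "('k::field \<Rightarrow> real) \<Rightarrow> 'k set \<Rightarrow> 'k set" where
  "integers_of abv K = {x\<in>K. abv x \<le> 1}"

text \<open>
  Unramified means that the value group does not grow; the residue field extension is then
  separable because the residue field of \<open>\<rat>\<^sub>p\<close> is finite.
\<close>

definition unramified_extension :: "('k::field_char_0 \<Rightarrow> real) \<Rightarrow> nat \<Rightarrow> 'k set \<Rightarrow> bool" where
  "unramified_extension abv s L \<longleftrightarrow>
     is_subfield L \<and> closure_of_rationals abv \<subseteq> L \<and>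
     (\<exists>S. finite S \<and> card S = s \<and> basis_modulo (closure_of_rationals abv) (*) L {0} S) \<and>
     abv ` (L - {0}) = abv ` (closure_of_rationals abv - {0})"

text \<open>
  \<open>red\<close> identifies the residue field of \<open>L\<close> with the field \<open>'f\<close>; its values outside the ring of
  integers of \<open>L\<close> are irrelevant.
\<close>

definition reduction_map :: "('k::field \<Rightarrow> real) \<Rightarrow> 'k set \<Rightarrow> ('k \<Rightarrow> 'f::field) \<Rightarrow> bool" where
  "reduction_map abv L red \<longleftrightarrow>
     red 1 = 1 \<and>
     (\<forall>x\<in>integers_of abv L. \<forall>y\<in>integers_of abv L.
        red (x + y) = red x + red y \<and> red (x * y) = red x * red y) \<and>
     red ` integers_of abv L = UNIV \<and>
     (\<forall>x\<in>integers_of abv L. red x = 0 \<longleftrightarrow> abv x < 1)"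

definition teichmuller_representative ::
  "('k::field \<Rightarrow> real) \<Rightarrow> 'k set \<Rightarrow> ('k \<Rightarrow> 'f::{field, finite}) \<Rightarrow> 'f \<Rightarrow> 'k \<Rightarrow> bool" where
  "teichmuller_representative abv L red y x \<longleftrightarrow>
     x \<in> integers_of abv L \<and> red x = y \<and> x ^ CARD('f) = x"


section \<open>Exponents, weights and the set \<open>\<B>\<close>\<close>

text \<open>
  The index set \<open>{1..n}\<close> is a finite linearly ordered type \<open>'n\<close>, with \<open>n = CARD('n)\<close>.
\<close>

definition expA :: "('n::finite \<Rightarrow> nat) \<Rightarrow> 'n \<Rightarrow> int^'n" where
  "expA a j = (\<chi> i. if i = j then int (a j) else 0)"

definition expG :: "('n::finite \<Rightarrow> nat) \<Rightarrow> int^'n" where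
  "expG d = (\<chi> i. - int (d i))"

definition real_vec :: "int^'n \<Rightarrow> real^'n" where
  "real_vec v = (\<chi> i. real_of_int (v $ i))"

definition polytope_Delta :: "('n::finite \<Rightarrow> nat) \<Rightarrow> ('n \<Rightarrow> nat) \<Rightarrow> (real^'n) set" where
  "polytope_Delta a d =
     convex hull ({0} \<union> range (\<lambda>j. real_vec (expA a j)) \<union> {real_vec (expG d)})"

definition weight :: "('n::finite \<Rightarrow> nat) \<Rightarrow> ('n \<Rightarrow> nat) \<Rightarrow> int^'n \<Rightarrow> rat" where
  "weight a d v =
     (LEAST c::rat. 0 \<le> c \<and> real_vec v \<in> (\<lambda>y. real_of_rat c *\<^sub>R y) ` polytope_Delta a d)"

definition estar :: "('n::finite \<Rightarrow> nat) \<Rightarrow> ('n \<Rightarrow> nat) \<Rightarrow> nat" where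
  "estar a d =
     (if CARD('n) = 1 then lcm (Lcm (range a)) (Lcm (range d)) else Lcm (range a) * Lcm (range d))"

text \<open>
  The number \<open>e\<^sup>* w(v)\<close>, which is a nonnegative integer; the floor only converts its type.
\<close>

definition eweight :: "('n::finite \<Rightarrow> nat) \<Rightarrow> ('n \<Rightarrow> nat) \<Rightarrow> int^'n \<Rightarrow> nat" where
  "eweight a d v = nat \<lfloor>of_nat (estar a d) * weight a d v\<rfloor>"

text \<open>
  For \<open>n = 1\<close> the condition on pairs is void, so that both cases of the definition are covered.
\<close>

definition setB :: "('n::{finite, linorder} \<Rightarrow> nat) \<Rightarrow> ('n \<Rightarrow> nat) \<Rightarrow> (int, 'n) vec set" where
  "setB a d =
     {v. (\<forall>i. - int (d i) < v $ i \<and> v $ i \<le> int (a i)) \<and>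
         (\<forall>i j. i < j \<longrightarrow>
            real (d j) / real (d i) * (of_int (v $ i) - real (a i)) \<le> of_int (v $ j) \<and>
            of_int (v $ j) < real (d j) / real (d i) * of_int (v $ i) + real (a j))}"


section \<open>Series and the operators \<open>D\<^sub>l\<close>\<close>

text \<open>
  A (possibly infinite) Laurent series \<open>\<Sum>\<^sub>u f u x\<^sup>u\<close> is the function \<open>f\<close> of its exponent \<open>u\<close>.
  Addition of functions is pointwise, but the pointwise product of functions is not the
  product of series and is not used.
\<close>

definition xmonom :: "int^'n \<Rightarrow> 'k::zero \<Rightarrow> (int^'n \<Rightarrow> 'k)" where
  "xmonom v c = (\<lambda>u. if u = v then c else 0)"

definition series_scale :: "'k::times \<Rightarrow> (int^'n \<Rightarrow> 'k) \<Rightarrow> (int^'n \<Rightarrow> 'k)" where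
  "series_scale r f = (\<lambda>u. r * f u)"

text \<open>The product \<open>g f\<close> for a Laurent polynomial \<open>g\<close>.\<close>

definition series_mult :: "(int^'n::finite \<Rightarrow> 'k::comm_ring_1) \<Rightarrow> (int^'n \<Rightarrow> 'k) \<Rightarrow> (int^'n \<Rightarrow> 'k)" where
  "series_mult g f = (\<lambda>u. \<Sum>v\<in>{v. g v \<noteq> 0}. g v * f (u - v))"

text \<open>The operator \<open>x\<^sub>l \<partial>/\<partial>x\<^sub>l\<close>.\<close>

definition euler_op :: "'n \<Rightarrow> (int^'n \<Rightarrow> 'k::comm_ring_1) \<Rightarrow> (int^'n \<Rightarrow> 'k)" where
  "euler_op l f = (\<lambda>u. of_int (u $ l) * f u)"

definition laurent_F :: "('n::finite \<Rightarrow> nat) \<Rightarrow> ('n \<Rightarrow> nat) \<Rightarrow> 'k::comm_ring_1 \<Rightarrow> (int^'n \<Rightarrow> 'k)" where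
  "laurent_F a d lam = (\<Sum>i\<in>UNIV. xmonom (expA a i) 1) + xmonom (expG d) lam"

definition opD ::
  "('n::finite \<Rightarrow> nat) \<Rightarrow> ('n \<Rightarrow> nat) \<Rightarrow> 'k::comm_ring_1 \<Rightarrow> 'k \<Rightarrow> 'n \<Rightarrow> (int^'n \<Rightarrow> 'k) \<Rightarrow> (int^'n \<Rightarrow> 'k)" where
  "opD a d pi_el lam l f =
     euler_op l f + series_scale pi_el (series_mult (euler_op l (laurent_F a d lam)) f)"

text \<open>
  In \<open>C0\<close> and \<open>hatB\<close>, \<open>tpi\<close> is the \<open>e\<^sup>*\<close>-th root of \<open>\<pi>\<close>. Convergence as \<open>u \<rightarrow> \<infinity>\<close> in the
  discrete set of exponents is convergence along the cofinite filter.
\<close>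

definition C0 ::
  "('n::finite \<Rightarrow> nat) \<Rightarrow> ('n \<Rightarrow> nat) \<Rightarrow> ('k::field \<Rightarrow> real) \<Rightarrow> 'k set \<Rightarrow> 'k \<Rightarrow> (int^'n \<Rightarrow> 'k) set" where
  "C0 a d abv R tpi =
     {(\<lambda>u. c u * tpi ^ eweight a d u) | c. (\<forall>u. c u \<in> R) \<and> ((\<lambda>u. abv (c u)) \<longlongrightarrow> 0) cofinite}"

definition hatB ::
  "('n::{finite, linorder} \<Rightarrow> nat) \<Rightarrow> ('n \<Rightarrow> nat) \<Rightarrow> 'k::field \<Rightarrow> ((int, 'n) vec \<Rightarrow> 'k) set" where
  "hatB a d tpi = (\<lambda>v. xmonom v (tpi ^ eweight a d v)) ` setB a d"

definition sum_of_images :: "('n::finite \<Rightarrow> 'm \<Rightarrow> 'm) \<Rightarrow> 'm set \<Rightarrow> 'm::ab_group_add set" where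
  "sum_of_images D M = {(\<Sum>l\<in>UNIV. D l (g l)) | g. \<forall>l. g l \<in> M}"


section \<open>The Koszul complex\<close>

text \<open>
  A form is given by its coefficients: \<open>\<omega> J\<close> is the coefficient of
  \<open>dx\<^bsub>j1\<^esub>/x\<^bsub>j1\<^esub> \<and> \<dots> \<and> dx\<^bsub>ji\<^esub>/x\<^bsub>ji\<^esub>\<close>, where \<open>J = {j1 < \<dots> < ji}\<close>. Moving
  \<open>dx\<^sub>l/x\<^sub>l\<close> from the front to its place in this product gives the sign
  \<open>(-1) ^ card {j\<in>J. j < l}\<close>.
\<close>

definition koszul_forms :: "'m set \<Rightarrow> nat \<Rightarrow> ('n::finite set \<Rightarrow> 'm::ab_group_add) set" where
  "koszul_forms M i =
     {\<omega>. (\<forall>J. card J = i \<longrightarrow> \<omega> J \<in> M) \<and> (\<forall>J. card J \<noteq> i \<longrightarrow> \<omega> J = 0)}"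

definition koszul_nabla ::
  "('n \<Rightarrow> 'm \<Rightarrow> 'm) \<Rightarrow> ('n::{finite, linorder} set \<Rightarrow> 'm) \<Rightarrow> ('n set \<Rightarrow> 'm::ab_group_add)" where
  "koszul_nabla D \<omega> =
     (\<lambda>J. \<Sum>l\<in>J. if even (card {j\<in>J. j < l}) then D l (\<omega> (J - {l})) else - D l (\<omega> (J - {l})))"

definition koszul_cocycles ::
  "('n \<Rightarrow> 'm \<Rightarrow> 'm) \<Rightarrow> 'm set \<Rightarrow> nat \<Rightarrow> ('n::{finite, linorder} set \<Rightarrow> 'm::ab_group_add) set" where
  "koszul_cocycles D M i = {\<omega> \<in> koszul_forms M i. koszul_nabla D \<omega> = 0}"

definition koszul_coboundaries ::
  "('n \<Rightarrow> 'm \<Rightarrow> 'm) \<Rightarrow> 'm set \<Rightarrow> nat \<Rightarrow> ('n::{finite, linorder} set \<Rightarrow> 'm::ab_group_add) set" where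
  "koszul_coboundaries D M i =
     (if i = 0 then {0} else koszul_nabla D ` koszul_forms M (i - 1))"

definition form_scale :: "('r \<Rightarrow> 'm \<Rightarrow> 'm) \<Rightarrow> 'r \<Rightarrow> ('n set \<Rightarrow> 'm) \<Rightarrow> ('n set \<Rightarrow> 'm)" where
  "form_scale sc r \<omega> = (\<lambda>J. sc r (\<omega> J))"

text \<open>The form \<open>f dx\<^sub>1/x\<^sub>1 \<and> \<dots> \<and> dx\<^sub>n/x\<^sub>n\<close>.\<close>

definition top_form :: "'m \<Rightarrow> ('n set \<Rightarrow> 'm::zero)" where
  "top_form f = (\<lambda>J. if J = UNIV then f else 0)"

end

theory Submission
  imports Defs
begin

text \<open>
  Write \<open>e u = t ^ W u x\<^sup>u\<close>, where \<open>t\<close> is the \<open>e\<^sup>*\<close>-th root of \<open>\<pi>\<close> and \<open>W = e\<^sup>* w\<close>. For a linear form \<open>\<sigma>\<close>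
  which vanishes on all but two of the vertices of the simplex, say on all but \<open>V\<^sub>i\<close> and \<open>V\<^sub>j\<close>, the
  combination \<open>D\<^sub>\<sigma>\<close> of the \<open>D\<^sub>l\<close> maps \<open>e u\<close> to a combination of \<open>e u\<close>, \<open>e (u + V\<^sub>i)\<close> and \<open>e (u + V\<^sub>j)\<close>
  with integral coefficients. If \<open>u\<close> lies in the cone over the facet opposite to \<open>V\<^sub>i\<close> (ties between the facets
  are broken by a linear order on them), then \<open>e (u + V\<^sub>j)\<close> has a unit as its coefficient, and the other two
  exponents are smaller with respect to a refinement of the weight. So this relation eliminates the exponent
  \<open>u + V\<^sub>j\<close>, and \<open>\<B>\<close> consists of the exponents which are not eliminated by any relation.
  This gives generation, with the help of completeness for infinite series. An exponent may be eliminated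
  by several relations, but since the operators commute, these agree modulo relations for smaller
  exponents. Hence any values on \<open>\<B>\<close> extend to an integral linear functional on polynomials which kills
  the images of the \<open>D\<^sub>l\<close>. Applied to finite truncations of a series, these functionals give independence.
\<close>

section \<open>Nonarchimedean absolute values\<close>

text \<open>All coordinates of \<open>expG d\<close> are negative, so 0 is interior to the polytope:
  its facets correspond to the n+1 nonzero vertices, and the cones over them cover the space. Up to
  scaling, a form that kills n-1 of these vertices is a coordinate x_l or some d_m x_k - d_k x_m.
  Its values at the two remaining vertices are, up to sign, products of numbers a_i and d_i; this is
  where indivisibility by p makes the pivots units. The weight alone does not order the exponents
  well enough: if u lies on several closed cones, u + V_i can have the same weight as u + V_j. It
  has then passed to a tied cone of larger rank, so the rank supplies the refinement, and the same
  ranking decides which inequalities in the definition of B are strict. Refined weights are natural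
  numbers, hence both the elimination and the recursive construction of a functional terminate
  directly over the integers of the field, without reduction modulo t. The field theory is there to
  show that the coefficient field is complete.\<close>

lemma is_subfieldD:
  assumes "is_subfield K"
  shows "0 \<in> K" "1 \<in> K" "x \<in> K \<Longrightarrow> y \<in> K \<Longrightarrow> x + y \<in> K" "x \<in> K \<Longrightarrow> y \<in> K \<Longrightarrow> x * y \<in> K"
    "x \<in> K \<Longrightarrow> - x \<in> K" "x \<in> K \<Longrightarrow> inverse x \<in> K" "x \<in> K \<Longrightarrow> y \<in> K \<Longrightarrow> x - y \<in> K"
    "x \<in> K \<Longrightarrow> x ^ n \<in> K" "of_nat n \<in> K" "of_int k \<in> K"
proof -
  show *: "0 \<in> K" "1 \<in> K" "x \<in> K \<Longrightarrow> y \<in> K \<Longrightarrow> x + y \<in> K" "x \<in> K \<Longrightarrow> y \<in> K \<Longrightarrow> x * y \<in> K"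
    "x \<in> K \<Longrightarrow> - x \<in> K" "x \<in> K \<Longrightarrow> inverse x \<in> K" for x y
    using assms by (auto simp: is_subfield_def)
  show "x \<in> K \<Longrightarrow> y \<in> K \<Longrightarrow> x - y \<in> K"
    using *(3)[of x "- y"] *(5)[of y] by simp
  show "x ^ n \<in> K" if "x \<in> K"
    by (induction n) (use * that in auto)
  show nat: "of_nat n \<in> K" for n
    by (induction n) (use * in auto)
  show "of_int k \<in> K"
    by (cases k) (use nat *(5) in \<open>auto simp flip: of_nat_Suc simp del: of_nat_Suc\<close>)
qed

locale nonarch =
  fixes abv :: "'k::field \<Rightarrow> real"
  assumes abv: "is_absolute_value abv"
begin

lemma abv_nonneg [simp]: "0 \<le> abv x"
  and abv_eq_0_iff [simp]: "abv x = 0 \<longleftrightarrow> x = 0"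
  and abv_mult: "abv (x * y) = abv x * abv y"
  and abv_add: "abv (x + y) \<le> max (abv x) (abv y)"
  using abv unfolding is_absolute_value_def by auto

lemma abv_0 [simp]: "abv 0 = 0" by simp

lemma abv_1 [simp]: "abv 1 = 1"
proof -
  have "abv 1 * abv 1 = abv 1" using abv_mult[of 1 1] by simp
  moreover have "abv 1 \<noteq> 0" by (subst abv_eq_0_iff) simp
  ultimately show ?thesis by simp
qed

lemma abv_pos: "x \<noteq> 0 \<Longrightarrow> 0 < abv x"
  using abv_nonneg[of x] abv_eq_0_iff[of x] by linarith

lemma abv_power: "abv (x ^ n) = abv x ^ n"
  by (induction n) (auto simp: abv_mult)

lemma abv_minus [simp]: "abv (- x) = abv x"
proof -
  have "abv (-1) * abv (-1) = 1" using abv_mult[of "-1" "-1"] by simp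
  hence "abv (-1) = 1" using abv_nonneg[of "-1"]
    by (metis abs_of_nonneg power2_eq_square real_sqrt_abs real_sqrt_one)
  thus ?thesis using abv_mult[of "-1" x] by simp
qed

lemma abv_minus_commute: "abv (x - y) = abv (y - x)"
  using abv_minus[of "x - y"] by simp

lemma abv_diff: "abv (x - y) \<le> max (abv x) (abv y)"
  using abv_add[of x "- y"] by simp

lemma abv_add_le: "abv x \<le> e \<Longrightarrow> abv y \<le> e \<Longrightarrow> abv (x + y) \<le> e"
  using abv_add[of x y] by linarith

lemma abv_add_less: "abv x < e \<Longrightarrow> abv y < e \<Longrightarrow> abv (x + y) < e"
  using abv_add[of x y] by linarith

lemma abv_diff_less: "abv x < e \<Longrightarrow> abv y < e \<Longrightarrow> abv (x - y) < e"
  using abv_diff[of x y] by linarith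

lemma abv_diff_trans: "abv (x - y) < e \<Longrightarrow> abv (y - z) < e \<Longrightarrow> abv (x - z) < e"
  using abv_add_less[of "x - y" e "y - z"] by simp

lemma abv_sum_le:
  assumes "\<And>i. i \<in> A \<Longrightarrow> abv (f i) \<le> e" "0 \<le> e"
  shows "abv (sum f A) \<le> e"
  using assms
  by (induction A rule: infinite_finite_induct) (auto intro: abv_add_le)

lemma abv_sum_less:
  assumes "\<And>i. i \<in> A \<Longrightarrow> abv (f i) < e" "0 < e"
  shows "abv (sum f A) < e"
  using assms
  by (induction A rule: infinite_finite_induct) (auto intro: abv_add_less)

lemma abv_inverse: "abv (inverse x) = inverse (abv x)"
proof (cases "x = 0")
  case False
  hence "abv x * abv (inverse x) = 1" using abv_mult[of x "inverse x"] by simp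
  thus ?thesis by (metis inverse_unique)
qed simp

lemma abv_divide: "abv (x / y) = abv x / abv y"
  by (simp add: field_class.field_divide_inverse abv_mult abv_inverse divide_inverse)

lemma abv_of_nat_le: "abv (of_nat n) \<le> 1"
  by (induction n) (auto intro: abv_add_le)

lemma abv_of_int_le: "abv (of_int k) \<le> 1"
  by (cases k) (auto simp flip: of_nat_Suc intro: abv_of_nat_le simp del: of_nat_Suc)

text \<open>By Bezout 1 = x m + y p; if m and p both had absolute value below 1, so would 1.\<close>

lemma abv_of_nat_unit:
  assumes "abv (of_nat p) < 1" "coprime m p"
  shows "abv (of_nat m) = 1"
proof (rule ccontr)
  assume "abv (of_nat m) \<noteq> 1"
  hence lt: "abv (of_nat m) < 1" using abv_of_nat_le[of m] by linarith
  have "coprime (int m) (int p)" using assms(2) by simp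
  then obtain x y where "x * int m + y * int p = 1"
    by (metis bezout_int coprime_imp_gcd_eq_1)
  hence eq: "of_int x * of_nat m + of_int y * of_nat p = (1::'k)"
    by (metis of_int_1 of_int_add of_int_mult of_int_of_nat_eq)
  have "abv (of_int x * of_nat m) < 1" "abv (of_int y * of_nat p) < 1"
    using lt assms(1) abv_of_int_le[of x] abv_of_int_le[of y]
    by (auto simp: abv_mult intro: le_less_trans[OF mult_left_le_one_le])
  from abv_add_less[OF this] eq show False by simp
qed

text \<open>Convergence along the net of finite subsets: the index set will be the lattice of
  exponents, which carries no preferred enumeration.\<close>

definition has_abv_sum :: "('i \<Rightarrow> 'k) \<Rightarrow> 'k \<Rightarrow> bool" where
  "has_abv_sum f x \<longleftrightarrow>
     (\<forall>e>0. \<exists>F0. finite F0 \<and> (\<forall>F. finite F \<and> F0 \<subseteq> F \<longrightarrow> abv (sum f F - x) < e))"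

lemma has_abv_sum_unique:
  assumes "has_abv_sum f x" "has_abv_sum f y"
  shows "x = y"
proof (rule ccontr)
  assume "x \<noteq> y"
  hence e: "abv (x - y) > 0" by (simp add: abv_pos)
  obtain F1 where F1: "finite F1" "\<And>F. finite F \<Longrightarrow> F1 \<subseteq> F \<Longrightarrow> abv (sum f F - x) < abv (x - y)"
    using assms(1) e unfolding has_abv_sum_def by meson
  obtain F2 where F2: "finite F2" "\<And>F. finite F \<Longrightarrow> F2 \<subseteq> F \<Longrightarrow> abv (sum f F - y) < abv (x - y)"
    using assms(2) e unfolding has_abv_sum_def by meson
  have "abv (x - sum f (F1 \<union> F2)) < abv (x - y)"
    using F1(2)[of "F1 \<union> F2"] F1(1) F2(1) by (simp add: abv_minus_commute)
  moreover have "abv (sum f (F1 \<union> F2) - y) < abv (x - y)"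
    using F2(2)[of "F1 \<union> F2"] F1(1) F2(1) by simp
  ultimately show False using abv_diff_trans by blast
qed

lemma has_abv_sum_add:
  assumes "has_abv_sum f x" "has_abv_sum g y"
  shows "has_abv_sum (\<lambda>i. f i + g i) (x + y)"
  unfolding has_abv_sum_def
proof (intro allI impI)
  fix e :: real assume e: "e > 0"
  obtain F1 where F1: "finite F1" "\<And>F. finite F \<Longrightarrow> F1 \<subseteq> F \<Longrightarrow> abv (sum f F - x) < e"
    using assms(1) e unfolding has_abv_sum_def by meson
  obtain F2 where F2: "finite F2" "\<And>F. finite F \<Longrightarrow> F2 \<subseteq> F \<Longrightarrow> abv (sum g F - y) < e"
    using assms(2) e unfolding has_abv_sum_def by meson
  have "abv ((\<Sum>i\<in>F. f i + g i) - (x + y)) < e" if "finite F" "F1 \<union> F2 \<subseteq> F" for F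
    using abv_add_less[OF F1(2)[of F] F2(2)[of F]] that by (simp add: sum.distrib algebra_simps)
  thus "\<exists>F0. finite F0 \<and> (\<forall>F. finite F \<and> F0 \<subseteq> F \<longrightarrow> abv ((\<Sum>i\<in>F. f i + g i) - (x + y)) < e)"
    using F1(1) F2(1) by (intro exI[of _ "F1 \<union> F2"]) auto
qed

lemma has_abv_sum_cmult:
  assumes "has_abv_sum f x"
  shows "has_abv_sum (\<lambda>i. c * f i) (c * x)"
proof (cases "c = 0")
  case True
  thus ?thesis unfolding has_abv_sum_def by auto
next
  case False
  show ?thesis unfolding has_abv_sum_def
  proof (intro allI impI)
    fix e :: real assume "e > 0"
    hence e: "e / abv c > 0" using False by (simp add: abv_pos)
    obtain F0 where F0: "finite F0" "\<And>F. finite F \<Longrightarrow> F0 \<subseteq> F \<Longrightarrow> abv (sum f F - x) < e / abv c"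
      using assms e unfolding has_abv_sum_def by meson
    have "abv ((\<Sum>i\<in>F. c * f i) - c * x) < e" if "finite F" "F0 \<subseteq> F" for F
    proof -
      have "(\<Sum>i\<in>F. c * f i) - c * x = c * (sum f F - x)"
        by (simp add: sum_distrib_left right_diff_distrib)
      thus ?thesis using F0(2)[OF that] False
        by (simp add: abv_mult pos_less_divide_eq abv_pos mult.commute)
    qed
    thus "\<exists>F0. finite F0 \<and> (\<forall>F. finite F \<and> F0 \<subseteq> F \<longrightarrow> abv ((\<Sum>i\<in>F. c * f i) - c * x) < e)"
      using F0(1) by blast
  qed
qed

lemma has_abv_sum_finite_sum:
  assumes "finite A" "\<And>j. j \<in> A \<Longrightarrow> has_abv_sum (f j) (x j)"
  shows "has_abv_sum (\<lambda>i. \<Sum>j\<in>A. f j i) (\<Sum>j\<in>A. x j)"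
  using assms
  by (induction A rule: finite_induct) (auto intro: has_abv_sum_add simp: has_abv_sum_def[of "\<lambda>_. 0"])

lemma has_abv_sum_single: "has_abv_sum (\<lambda>i. if i = j then x else 0) x"
  unfolding has_abv_sum_def
proof (intro allI impI)
  fix e :: real assume "e > 0"
  thus "\<exists>F0. finite F0 \<and> (\<forall>F. finite F \<and> F0 \<subseteq> F \<longrightarrow>
           abv ((\<Sum>i\<in>F. if i = j then x else 0) - x) < e)"
    by (intro exI[of _ "{j}"]) (auto simp: sum.delta)
qed

lemma has_abv_sum_le:
  assumes "has_abv_sum f x" "\<And>i. abv (f i) \<le> e" "0 \<le> e"
  shows "abv x \<le> e"
proof (rule field_le_epsilon)
  fix d :: real assume d: "d > 0"
  then obtain F where F: "finite F" "abv (sum f F - x) < d"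
    using assms(1) unfolding has_abv_sum_def by blast
  have "abv (sum f F) \<le> e" by (intro abv_sum_le assms)
  thus "abv x \<le> e + d"
    using F(2) abv_diff[of "sum f F" "sum f F - x"] assms(3) d by simp
qed

lemma complete_underD:
  assumes "complete_under abv K" "\<And>i::nat. X i \<in> K"
    and "\<And>e. e > 0 \<Longrightarrow> \<exists>N. \<forall>i\<ge>N. \<forall>j\<ge>N. abv (X i - X j) < e"
  obtains x where "x \<in> K" "\<And>e. e > 0 \<Longrightarrow> \<exists>N. \<forall>i\<ge>N. abv (X i - x) < e"
proof -
  have "(\<forall>i. X i \<in> K) \<and> (\<forall>e>0. \<exists>N. \<forall>i\<ge>N. \<forall>j\<ge>N. abv (X i - X j) < e)"
    using assms(2,3) by blast
  then obtain x where "x \<in> K" and lim: "(\<lambda>i. abv (X i - x)) \<longlonglongrightarrow> 0"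
    using assms(1)[unfolded complete_under_def, rule_format, of X] by blast
  moreover have "\<exists>N. \<forall>i\<ge>N. abv (X i - x) < e" if "e > 0" for e
    using LIMSEQ_D[OF lim that] by auto
  ultimately show thesis using that by blast
qed

lemma complete_underI:
  assumes "\<And>X::nat \<Rightarrow> 'k. (\<And>i. X i \<in> K) \<Longrightarrow>
      (\<And>e. e > 0 \<Longrightarrow> \<exists>N. \<forall>i\<ge>N. \<forall>j\<ge>N. abv (X i - X j) < e) \<Longrightarrow>
      \<exists>x\<in>K. \<forall>e>0. \<exists>N. \<forall>i\<ge>N. abv (X i - x) < e"
  shows "complete_under abv K"
  unfolding complete_under_def
proof (intro allI impI, elim conjE)
  fix X :: "nat \<Rightarrow> 'k"
  assume "\<forall>i. X i \<in> K" "\<forall>e>0. \<exists>N. \<forall>i\<ge>N. \<forall>j\<ge>N. abv (X i - X j) < e"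
  then obtain x where "x \<in> K" and x: "\<forall>e>0. \<exists>N. \<forall>i\<ge>N. abv (X i - x) < e"
    using assms[of X] by blast
  moreover have "(\<lambda>i. abv (X i - x)) \<longlonglongrightarrow> 0"
    using x by (intro LIMSEQ_I) simp
  ultimately show "\<exists>x\<in>K. (\<lambda>i. abv (X i - x)) \<longlonglongrightarrow> 0" by blast
qed

text \<open>In the ultrametric case it suffices that the terms tend to 0: a finite sum of terms
  outside \<open>F k\<close> stays below 1/(k+1), so the sums over the sets \<open>F k\<close> form
  a Cauchy sequence, and its limit is the sum.\<close>

lemma has_abv_sum_exists:
  fixes f :: "'i \<Rightarrow> 'k"
  assumes "complete_under abv K"
    and K: "0 \<in> K" "\<And>x y. x \<in> K \<Longrightarrow> y \<in> K \<Longrightarrow> x + y \<in> K"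
    and f: "\<And>i. f i \<in> K"
    and fin: "\<And>e. e > 0 \<Longrightarrow> finite {i. e \<le> abv (f i)}"
  obtains x where "x \<in> K" "has_abv_sum f x"
proof -
  define F where "F k = {i. 1 / real (Suc k) \<le> abv (f i)}" for k
  have finF: "finite (F k)" for k unfolding F_def by (rule fin) simp
  have sumK: "sum f A \<in> K" for A
    by (induction A rule: infinite_finite_induct) (auto intro: K f)
  have tail: "abv (sum f A - sum f (F k)) < 1 / real (Suc k)"
    if "finite A" "F k \<subseteq> A" for A k
  proof -
    have "sum f A - sum f (F k) = sum f (A - F k)"
      using that sum_diff[of A "F k" f] by simp
    also have "abv \<dots> < 1 / real (Suc k)"
      by (rule abv_sum_less) (auto simp: F_def)
    finally show ?thesis .
  qed
  have mono: "F k \<subseteq> F l" if "k \<le> l" for k l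
  proof
    fix i assume "i \<in> F k"
    moreover have "1 / real (Suc l) \<le> 1 / real (Suc k)"
      using that by (simp add: field_simps)
    ultimately show "i \<in> F l" unfolding F_def by simp
  qed
  have small: "\<exists>N. 1 / real (Suc N) < e" if "e > 0" for e
    using reals_Archimedean[OF that] by (simp add: inverse_eq_divide)
  obtain x where x: "x \<in> K" "\<And>e. e > 0 \<Longrightarrow> \<exists>N. \<forall>i\<ge>N. abv (sum f (F i) - x) < e"
  proof (rule complete_underD[OF assms(1), of "\<lambda>k. sum f (F k)"])
    fix e :: real assume "e > 0"
    then obtain N where N: "1 / real (Suc N) < e" using small by blast
    have "abv (sum f (F i) - sum f (F j)) < e" if "i \<ge> N" "j \<ge> N" for i j
    proof (rule abv_diff_trans)
      show "abv (sum f (F i) - sum f (F N)) < e"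
        using tail[OF finF mono[OF that(1)]] N by linarith
      show "abv (sum f (F N) - sum f (F j)) < e"
        using tail[OF finF mono[OF that(2)]] N by (subst abv_minus_commute) linarith
    qed
    thus "\<exists>N. \<forall>i\<ge>N. \<forall>j\<ge>N. abv (sum f (F i) - sum f (F j)) < e" by blast
  qed (auto intro: sumK)
  have "has_abv_sum f x" unfolding has_abv_sum_def
  proof (intro allI impI)
    fix e :: real assume e: "e > 0"
    obtain N where N: "1 / real (Suc N) < e" using small e by blast
    obtain N' where N': "\<forall>i\<ge>N'. abv (sum f (F i) - x) < e" using x(2)[OF e] by blast
    define k where "k = max N N'"
    have k: "1 / real (Suc k) \<le> 1 / real (Suc N)" by (simp add: k_def field_simps)
    have "abv (sum f A - x) < e" if "finite A" "F k \<subseteq> A" for A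
    proof (rule abv_diff_trans)
      show "abv (sum f A - sum f (F k)) < e" using tail[OF that] k N by linarith
      show "abv (sum f (F k) - x) < e" using N' by (simp add: k_def)
    qed
    thus "\<exists>F0. finite F0 \<and> (\<forall>A. finite A \<and> F0 \<subseteq> A \<longrightarrow> abv (sum f A - x) < e)"
      using finF by blast
  qed
  thus thesis using x(1) that by blast
qed

section \<open>Finite extensions of complete fields\<close>

text \<open>If x is outside W, then x has a positive distance \<delta> from the complete, hence
  closed, space W. After division by c this bounds \<delta> |c| by |w + c x|, so both components of
  a Cauchy sequence are Cauchy.\<close>

lemma complete_span_insert:
  assumes K: "is_subfield K" "complete_under abv K"
    and W: "0 \<in> W" "\<And>v w. v \<in> W \<Longrightarrow> w \<in> W \<Longrightarrow> v + w \<in> W" "\<And>c w. c \<in> K \<Longrightarrow> w \<in> W \<Longrightarrow> c * w \<in> W"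
    and cW: "complete_under abv W"
  shows "complete_under abv {w + c * x | w c. w \<in> W \<and> c \<in> K}"
proof (cases "x \<in> W")
  case True
  have "{w + c * x | w c. w \<in> W \<and> c \<in> K} = W"
  proof
    show "{w + c * x | w c. w \<in> W \<and> c \<in> K} \<subseteq> W" using W True by auto
    show "W \<subseteq> {w + c * x | w c. w \<in> W \<and> c \<in> K}"
    proof
      fix w assume "w \<in> W"
      moreover have "w = w + 0 * x" "0 \<in> K" using K(1) by (auto simp: is_subfield_def)
      ultimately show "w \<in> {w + c * x | w c. w \<in> W \<and> c \<in> K}" by blast
    qed
  qed
  thus ?thesis using cW by simp
next
  case False
  have Wneg: "- w \<in> W" if "w \<in> W" for w
    using W(3)[of "- 1" w] that is_subfieldD[OF K(1)] by simp
  have Wdiff: "v - w \<in> W" if "v \<in> W" "w \<in> W" for v w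
    using W(2)[OF that(1) Wneg[OF that(2)]] by simp
  \<comment> \<open>\<open>W\<close> is closed, so \<open>x\<close> has positive distance from it.\<close>
  have "\<exists>\<delta>>0. \<forall>w\<in>W. \<delta> \<le> abv (x + w)"
  proof (rule ccontr)
    assume "\<not> ?thesis"
    hence *: "\<exists>w\<in>W. abv (x + w) < \<delta>" if "\<delta> > 0" for \<delta>
      using that by (meson not_le)
    have "\<exists>w\<in>W. abv (w - x) < 1 / real (Suc k)" for k
    proof -
      obtain w where w: "w \<in> W" "abv (x + w) < 1 / real (Suc k)" using *[of "1 / real (Suc k)"] by auto
      have "abv (- w - x) = abv (x + w)" using abv_minus[of "w + x"] by (simp add: add.commute)
      thus ?thesis using w Wneg by metis
    qed
    then obtain X where X: "\<And>k. X k \<in> W" "\<And>k. abv (X k - x) < 1 / real (Suc k)" by metis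
    have conv: "\<exists>N. \<forall>k\<ge>N. abv (X k - x) < e" if e: "e > 0" for e
    proof -
      obtain N where N: "1 / real (Suc N) < e"
        using reals_Archimedean[OF e] by (auto simp: inverse_eq_divide)
      have "abv (X k - x) < e" if "k \<ge> N" for k
      proof -
        have "1 / real (Suc k) \<le> 1 / real (Suc N)" using that by (simp add: field_simps)
        thus ?thesis using X(2)[of k] N by linarith
      qed
      thus ?thesis by blast
    qed
    obtain y where y: "y \<in> W" "\<And>e. e > 0 \<Longrightarrow> \<exists>N. \<forall>k\<ge>N. abv (X k - y) < e"
    proof (rule complete_underD[OF cW X(1)])
      fix e :: real assume e: "e > 0"
      obtain N where "\<forall>k\<ge>N. abv (X k - x) < e" using conv[OF e] by blast
      hence "abv (X i - X j) < e" if "i \<ge> N" "j \<ge> N" for i j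
        using abv_diff_trans[of "X i" x e "X j"] that by (simp add: abv_minus_commute)
      thus "\<exists>N. \<forall>i\<ge>N. \<forall>j\<ge>N. abv (X i - X j) < e" by blast
    qed blast
    have "x \<noteq> y" using y(1) False by blast
    hence e: "abv (x - y) > 0" by (simp add: abv_pos)
    obtain N N' where "\<forall>k\<ge>N. abv (X k - x) < abv (x - y)" "\<forall>k\<ge>N'. abv (X k - y) < abv (x - y)"
      using conv[OF e] y(2)[OF e] by blast
    hence "abv (x - X (max N N')) < abv (x - y)" "abv (X (max N N') - y) < abv (x - y)"
      by (auto simp: abv_minus_commute)
    thus False using abv_diff_trans by blast
  qed
  then obtain \<delta> where \<delta>: "\<delta> > 0" "\<And>w. w \<in> W \<Longrightarrow> \<delta> \<le> abv (x + w)" by blast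
  have bound: "\<delta> * abv c \<le> abv (w + c * x)" if "w \<in> W" "c \<in> K" for w c
  proof (cases "c = 0")
    case False
    have "\<delta> \<le> abv (x + inverse c * w)" using \<delta>(2) W(3) is_subfieldD(6)[OF K(1)] that by blast
    hence "abv c * \<delta> \<le> abv c * abv (x + inverse c * w)" by (simp add: mult_left_mono)
    also have "\<dots> = abv (c * (x + inverse c * w))" by (simp add: abv_mult)
    also have "c * (x + inverse c * w) = w + c * x"
      using False by (simp add: distrib_left mult.assoc[symmetric])
    finally show ?thesis by (simp add: mult.commute)
  qed simp
  show ?thesis
  proof (rule complete_underI)
    fix X :: "nat \<Rightarrow> 'k"
    assume "\<And>i. X i \<in> {w + c * x | w c. w \<in> W \<and> c \<in> K}"
    then obtain w c where X: "\<And>i. X i = w i + c i * x" and w: "\<And>i. w i \<in> W" and c: "\<And>i. c i \<in> K"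
      by (simp only: mem_Collect_eq) metis
    assume Cauchy: "\<And>e. e > 0 \<Longrightarrow> \<exists>N. \<forall>i\<ge>N. \<forall>j\<ge>N. abv (X i - X j) < e"
    have "x \<noteq> 0" using False W(1) by blast
    hence ax: "abv x > 0" by (simp add: abv_pos)
    have cC: "\<exists>N. \<forall>i\<ge>N. \<forall>j\<ge>N. abv (c i - c j) < e" if e: "e > 0" for e
    proof -
      obtain N where N: "\<forall>i\<ge>N. \<forall>j\<ge>N. abv (X i - X j) < \<delta> * e"
        using Cauchy[of "\<delta> * e"] \<delta>(1) e by auto
      have "abv (c i - c j) < e" if "i \<ge> N" "j \<ge> N" for i j
      proof -
        have "X i - X j = (w i - w j) + (c i - c j) * x" by (simp add: X algebra_simps)
        hence "\<delta> * abv (c i - c j) \<le> abv (X i - X j)"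
          using bound[OF Wdiff[OF w[of i] w[of j]] is_subfieldD(7)[OF K(1) c[of i] c[of j]]] by simp
        hence "\<delta> * abv (c i - c j) < \<delta> * e" using N that le_less_trans by blast
        thus ?thesis using \<delta>(1) by simp
      qed
      thus ?thesis by blast
    qed
    have wC: "\<exists>N. \<forall>i\<ge>N. \<forall>j\<ge>N. abv (w i - w j) < e" if e: "e > 0" for e
    proof -
      obtain N where N: "\<forall>i\<ge>N. \<forall>j\<ge>N. abv (X i - X j) < e" using Cauchy[OF e] by blast
      obtain N' where N': "\<forall>i\<ge>N'. \<forall>j\<ge>N'. abv (c i - c j) < e / abv x"
        using cC[of "e / abv x"] e ax by auto
      have "abv (w i - w j) < e" if "i \<ge> max N N'" "j \<ge> max N N'" for i j
      proof -
        have "w i - w j = (X i - X j) - (c i - c j) * x" by (simp add: X algebra_simps)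
        moreover have "abv (X i - X j) < e" using N that by simp
        moreover have "abv ((c i - c j) * x) < e"
          using N' that ax by (simp add: abv_mult pos_less_divide_eq)
        ultimately show ?thesis using abv_diff_less by metis
      qed
      thus ?thesis by blast
    qed
    obtain y where y: "y \<in> K" "\<And>e. e > 0 \<Longrightarrow> \<exists>N. \<forall>i\<ge>N. abv (c i - y) < e"
      using complete_underD[OF K(2) c cC] by blast
    obtain z where z: "z \<in> W" "\<And>e. e > 0 \<Longrightarrow> \<exists>N. \<forall>i\<ge>N. abv (w i - z) < e"
      using complete_underD[OF cW w wC] by blast
    have "\<exists>N. \<forall>i\<ge>N. abv (X i - (z + y * x)) < e" if e: "e > 0" for e
    proof -
      obtain N where N: "\<forall>i\<ge>N. abv (w i - z) < e" using z(2)[OF e] by blast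
      obtain N' where N': "\<forall>i\<ge>N'. abv (c i - y) < e / abv x"
        using y(2)[of "e / abv x"] e ax by auto
      have "abv (X i - (z + y * x)) < e" if "i \<ge> max N N'" for i
      proof -
        have "X i - (z + y * x) = (w i - z) + (c i - y) * x" by (simp add: X algebra_simps)
        moreover have "abv (w i - z) < e" using N that by simp
        moreover have "abv ((c i - y) * x) < e"
          using N' that ax by (simp add: abv_mult pos_less_divide_eq)
        ultimately show ?thesis using abv_add_less by metis
      qed
      thus ?thesis by blast
    qed
    thus "\<exists>l\<in>{w + c * x | w c. w \<in> W \<and> c \<in> K}. \<forall>e>0. \<exists>N. \<forall>i\<ge>N. abv (X i - l) < e"
      using y(1) z(1) by (intro bexI[of _ "z + y * x"]) auto
  qed
qed

lemma complete_span:
  assumes K: "is_subfield K" "complete_under abv K" and "finite S"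
  shows "complete_under abv {(\<Sum>s\<in>S. c s * s) | c. c ` S \<subseteq> K}"
  using assms(3)
proof (induction S rule: finite_induct)
  case empty
  show ?case by (rule complete_underI) auto
next
  case (insert x S)
  let ?W = "{(\<Sum>s\<in>S. c s * s) | c. c ` S \<subseteq> K}"
  have eq: "{(\<Sum>s\<in>insert x S. c s * s) | c. c ` insert x S \<subseteq> K} = {w + c * x | w c. w \<in> ?W \<and> c \<in> K}"
    (is "?L = ?R")
  proof (intro equalityI subsetI)
    fix y assume "y \<in> ?L"
    then obtain c where "y = (\<Sum>s\<in>insert x S. c s * s)" "c ` insert x S \<subseteq> K" by blast
    hence "y = (\<Sum>s\<in>S. c s * s) + c x * x" "c ` S \<subseteq> K" "c x \<in> K"
      using insert.hyps by auto
    thus "y \<in> ?R" by blast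
  next
    fix y assume "y \<in> ?R"
    then obtain c b where y: "y = (\<Sum>s\<in>S. c s * s) + b * x" "c ` S \<subseteq> K" "b \<in> K" by blast
    have "y = (\<Sum>s\<in>insert x S. (c(x := b)) s * s)"
      using insert.hyps y(1) by (auto simp: add.commute intro!: sum.cong)
    moreover have "(c(x := b)) ` insert x S \<subseteq> K" using y(2,3) by auto
    ultimately show "y \<in> ?L" by blast
  qed
  show ?case unfolding eq
  proof (rule complete_span_insert[OF K])
    show "0 \<in> ?W" using K(1) by (auto simp: is_subfield_def intro!: exI[of _ "\<lambda>_. 0"])
    show "v + w \<in> ?W" if "v \<in> ?W" "w \<in> ?W" for v w
    proof -
      obtain c where "v = (\<Sum>s\<in>S. c s * s)" "c ` S \<subseteq> K" using \<open>v \<in> ?W\<close> by blast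
      moreover obtain b where "w = (\<Sum>s\<in>S. b s * s)" "b ` S \<subseteq> K" using \<open>w \<in> ?W\<close> by blast
      ultimately show ?thesis using K(1)
        by (auto simp: is_subfield_def sum.distrib distrib_right image_subset_iff
                 intro!: exI[of _ "\<lambda>s. c s + b s"])
    qed
    show "r * w \<in> ?W" if "r \<in> K" "w \<in> ?W" for r w
    proof -
      obtain c where "w = (\<Sum>s\<in>S. c s * s)" "c ` S \<subseteq> K" using \<open>w \<in> ?W\<close> by blast
      thus ?thesis using K(1) \<open>r \<in> K\<close>
        by (auto simp: is_subfield_def sum_distrib_left mult.assoc image_subset_iff
                 intro!: exI[of _ "\<lambda>s. r * c s"])
    qed
  qed (rule insert.IH)
qed

end

section \<open>Generated subfields and the adjunction of radicals\<close>

lemma field_generated_subfield: "is_subfield (field_generated X)"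
  unfolding is_subfield_def field_generated_def by simp

lemma field_generated_superset: "X \<subseteq> field_generated X"
  unfolding field_generated_def by blast

lemma field_generated_subset: "is_subfield K \<Longrightarrow> X \<subseteq> K \<Longrightarrow> field_generated X \<subseteq> K"
  unfolding field_generated_def by blast

lemma is_subfield_sum:
  assumes "is_subfield K" "\<And>i. i \<in> A \<Longrightarrow> f i \<in> K"
  shows "sum f A \<in> K"
  using assms(2) by (induction A rule: infinite_finite_induct) (auto simp: is_subfieldD(1,3)[OF assms(1)])

lemma closure_of_rationals_subfield:
  fixes abv' :: "'a::field_char_0 \<Rightarrow> real"
  assumes "is_absolute_value abv'"
  shows "is_subfield (closure_of_rationals abv')"
proof -
  interpret A: nonarch abv' using assms by unfold_locales
  let ?K = "closure_of_rationals abv'"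
  have I: "x \<in> ?K" if "\<And>e. e > 0 \<Longrightarrow> \<exists>r. abv' (x - of_rat r) < e" for x
    using that by (auto simp: closure_of_rationals_def)
  have E: "\<exists>r. abv' (x - of_rat r) < e" if "x \<in> ?K" "e > 0" for x e
    using that by (auto simp: closure_of_rationals_def)
  have rat: "of_rat r \<in> ?K" for r
    by (rule I) (auto intro!: exI[of _ r])
  show ?thesis unfolding is_subfield_def
  proof (intro conjI ballI)
    show "0 \<in> ?K" "1 \<in> ?K" using rat[of 0] rat[of 1] by simp_all
  next
    fix x y assume xy: "x \<in> ?K" "y \<in> ?K"
    show "x + y \<in> ?K"
    proof (rule I)
      fix e :: real assume "e > 0"
      then obtain r s where "abv' (x - of_rat r) < e" "abv' (y - of_rat s) < e"
        using E xy by blast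
      from A.abv_add_less[OF this] show "\<exists>r. abv' (x + y - of_rat r) < e"
        by (intro exI[of _ "r + s"]) (simp add: of_rat_add algebra_simps)
    qed
    show "x * y \<in> ?K"
    proof (rule I)
      fix e :: real assume e: "e > 0"
      \<comment> \<open>The error splits as xy - rs = y (x - r) + r (y - s). Hence r is chosen
        first, and the tolerance for s depends on r.\<close>
      have "e / (abv' y + 1) > 0" using e by (simp add: add_nonneg_pos)
      then obtain r where r: "abv' (x - of_rat r) < e / (abv' y + 1)" using E xy by blast
      have "e / (abv' (of_rat r) + 1) > 0" using e by (simp add: add_nonneg_pos)
      then obtain s where s: "abv' (y - of_rat s) < e / (abv' (of_rat r) + 1)" using E xy by blast
      have *: "u * v < e" if "v < e / (u + 1)" "0 \<le> u" "0 \<le> v" for u v :: real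
      proof -
        have "u * v \<le> v * (u + 1)" using that by (simp add: algebra_simps)
        also have "\<dots> < e" using that by (simp add: pos_less_divide_eq)
        finally show ?thesis .
      qed
      have "abv' (y * (x - of_rat r)) < e" "abv' (of_rat r * (y - of_rat s)) < e"
        unfolding A.abv_mult using r s by (auto intro!: *)
      from A.abv_add_less[OF this] show "\<exists>r. abv' (x * y - of_rat r) < e"
        by (intro exI[of _ "r * s"]) (simp add: of_rat_mult algebra_simps)
    qed
  next
    fix x assume x: "x \<in> ?K"
    show "- x \<in> ?K"
    proof (rule I)
      fix e :: real assume "e > 0"
      then obtain r where "abv' (x - of_rat r) < e" using E x by blast
      thus "\<exists>r. abv' (- x - of_rat r) < e"
        using A.abv_minus[of "x - of_rat r"] by (intro exI[of _ "- r"]) (simp add: of_rat_minus)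
    qed
    show "inverse x \<in> ?K"
    proof (cases "x = 0")
      case True
      thus ?thesis using rat[of 0] by simp
    next
      case False
      hence ax: "abv' x > 0" by (rule A.abv_pos)
      show ?thesis
      proof (rule I)
        fix e :: real assume "e > 0"
        \<comment> \<open>Closeness within |x| forces |r| \<ge> |x|, so r is nonzero; the second
          bound then controls 1/x - 1/r = -(x - r)/(x r).\<close>
        hence "min (abv' x) (e * (abv' x * abv' x)) > 0" using ax by simp
        then obtain r where r: "abv' (x - of_rat r) < min (abv' x) (e * (abv' x * abv' x))"
          using E x by blast
        have "abv' x \<le> max (abv' (x - of_rat r)) (abv' (of_rat r))"
          using A.abv_add[of "x - of_rat r" "of_rat r"] by simp
        hence ge: "abv' x \<le> abv' (of_rat r)" using r by linarith
        hence "of_rat r \<noteq> (0 :: 'a)" using ax by auto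
        hence "inverse x - inverse (of_rat r) = - ((x - of_rat r) / (x * of_rat r))"
          using False by (simp add: field_simps)
        hence "inverse x - of_rat (inverse r) = - ((x - of_rat r) / (x * of_rat r))"
          by (simp only: of_rat_inverse)
        hence "abv' (inverse x - of_rat (inverse r)) = abv' (x - of_rat r) / (abv' x * abv' (of_rat r))"
          by (simp add: A.abv_divide A.abv_mult)
        also have "\<dots> \<le> abv' (x - of_rat r) / (abv' x * abv' x)"
          using ge ax by (intro divide_left_mono mult_left_mono mult_pos_pos) auto
        also have "\<dots> < e" using r ax by (simp add: pos_divide_less_eq)
        finally show "\<exists>r. abv' (inverse x - of_rat r) < e" by blast
      qed
    qed
  qed
qed

text \<open>Read f(x) = 0 as c + x g(x) = 0. If c is nonzero, the inverse of x is -g(x)/c; if c = 0,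
  cancelling x leaves an equation of smaller degree.\<close>

lemma inverse_in_subring:
  fixes x :: "'a::field"
  assumes G: "0 \<in> G" "\<And>x y. x \<in> G \<Longrightarrow> y \<in> G \<Longrightarrow> x + y \<in> G" "\<And>x y. x \<in> G \<Longrightarrow> y \<in> G \<Longrightarrow> x * y \<in> G"
    and K: "is_subfield K" "K \<subseteq> G"
    and x: "x \<in> G" "x \<noteq> 0"
    and f: "f \<noteq> 0" "\<And>i. coeff f i \<in> K" "poly f x = 0"
  shows "inverse x \<in> G"
  using f
proof (induction f)
  case (pCons c g)
  have g: "coeff g i \<in> K" for i using pCons.prems(2)[of "Suc i"] by simp
  have "poly h x \<in> G" if "\<And>i. coeff h i \<in> G" for h
    using that
  proof (induction h)
    case (pCons b h)
    have "b \<in> G" "\<And>i. coeff h i \<in> G" using pCons.prems[of 0] pCons.prems[of "Suc i" for i] by auto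
    thus ?case using pCons.IH G x by simp
  qed (use G in simp)
  hence pG: "poly g x \<in> G" using g K(2) by blast
  have eq: "c + x * poly g x = 0" using pCons.prems(3) by simp
  show ?case
  proof (cases "c = 0")
    case True
    thus ?thesis using pCons g eq x(2) by auto
  next
    case False
    have "c \<in> K" using pCons.prems(2)[of 0] by simp
    hence "- inverse c \<in> G" using is_subfieldD(5,6)[OF K(1)] K(2) by blast
    moreover have xg: "x * poly g x = - c" using eq by (metis minus_unique)
    have "x * (- inverse c * poly g x) = - inverse c * (x * poly g x)" by (rule mult.left_commute)
    hence "x * (- inverse c * poly g x) = 1" using False by (simp only: xg) simp
    hence "inverse x = - inverse c * poly g x" by (rule inverse_unique)
    ultimately show ?thesis using pG G(3) by metis
  qed
qed simp

text \<open>G is the F-span of 1, z, ..., z^(m-1), possibly with linear dependences. It is closed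
  under products because z^m lies in F, complete because powers are added one at a time, and closed
  under inverses because all elements are algebraic over K. The minimality clause allows a tower of
  such steps to be identified with a generated field.\<close>

lemma (in nonarch) complete_adjoin_root:
  assumes F: "is_subfield F" "complete_under abv F"
    and K: "is_subfield K" "K \<subseteq> F"
    and alg: "\<And>x. \<exists>f. f \<noteq> 0 \<and> (\<forall>i. coeff f i \<in> K) \<and> poly f x = 0"
    and z: "z ^ m \<in> F" "m > 0"
  obtains G where "is_subfield G" "complete_under abv G" "insert z F \<subseteq> G"
    "\<And>H. is_subfield H \<Longrightarrow> insert z F \<subseteq> H \<Longrightarrow> G \<subseteq> H"
proof
  note FD = is_subfieldD[OF F(1)]
  define V where "V n = {(\<Sum>i<n. c i * z ^ i) | c. \<forall>i. c i \<in> F}" for n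
  define G where "G = V m"
  have V0: "0 \<in> V n" for n
    unfolding V_def using FD(1) by (auto intro!: exI[of _ "\<lambda>_. 0"])
  have Vadd: "v + w \<in> V n" if v: "v \<in> V n" and w: "w \<in> V n" for v w n
  proof -
    obtain c where "v = (\<Sum>i<n. c i * z ^ i)" "\<forall>i. c i \<in> F" using v by (auto simp: V_def)
    moreover obtain b where "w = (\<Sum>i<n. b i * z ^ i)" "\<forall>i. b i \<in> F" using w by (auto simp: V_def)
    ultimately show ?thesis unfolding V_def using FD(3)
      by (auto simp: distrib_right sum.distrib intro!: exI[of _ "\<lambda>i. c i + b i"])
  qed
  have Vscale: "r * w \<in> V n" if r: "r \<in> F" and w: "w \<in> V n" for r w n
  proof -
    obtain c where "w = (\<Sum>i<n. c i * z ^ i)" "\<forall>i. c i \<in> F" using w by (auto simp: V_def)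
    thus ?thesis unfolding V_def using FD(4) r
      by (auto simp: sum_distrib_left mult.assoc intro!: exI[of _ "\<lambda>i. r * c i"])
  qed
  have Vcomplete: "complete_under abv (V n)" for n
  proof (induction n)
    case 0
    show ?case by (rule complete_underI) (auto simp: V_def)
  next
    case (Suc n)
    have "V (Suc n) = {w + c * z ^ n | w c. w \<in> V n \<and> c \<in> F}"
    proof (intro equalityI subsetI)
      fix y assume "y \<in> V (Suc n)"
      then obtain c where "y = (\<Sum>i<n. c i * z ^ i) + c n * z ^ n" "\<forall>i. c i \<in> F" by (auto simp: V_def)
      thus "y \<in> {w + c * z ^ n | w c. w \<in> V n \<and> c \<in> F}" unfolding V_def by blast
    next
      fix y assume "y \<in> {w + c * z ^ n | w c. w \<in> V n \<and> c \<in> F}"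
      then obtain c b where "y = (\<Sum>i<n. c i * z ^ i) + b * z ^ n" "\<forall>i. c i \<in> F" "b \<in> F"
        unfolding V_def by blast
      thus "y \<in> V (Suc n)" unfolding V_def
        by (auto intro!: exI[of _ "c(n := b)"] sum.cong)
    qed
    thus ?case using complete_span_insert[OF F V0 Vadd Vscale Suc.IH] by simp
  qed
  have zG: "z ^ k \<in> G" for k
  proof -
    have "z ^ (k mod m) = (\<Sum>i<m. (if i = k mod m then 1 else 0) * z ^ i)"
      using z(2) by (simp add: if_distrib[of "\<lambda>x. x * _"] cong: if_cong)
    hence "z ^ (k mod m) \<in> V m" unfolding V_def using FD(1,2) by fastforce
    moreover have "z ^ k = (z ^ m) ^ (k div m) * z ^ (k mod m)"
      by (metis mult.commute mult_div_mod_eq power_add power_mult)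
    ultimately show ?thesis unfolding G_def using Vscale[OF FD(8)[OF z(1)]] by simp
  qed
  have Gsum: "sum f A \<in> G" if "\<And>i. i \<in> A \<Longrightarrow> f i \<in> G" for f and A :: "nat set"
    using that unfolding G_def by (induction A rule: infinite_finite_induct) (auto intro: V0 Vadd)
  have Gmult: "v * w \<in> G" if v: "v \<in> G" and w: "w \<in> G" for v w
  proof -
    obtain c where c: "v = (\<Sum>i<m. c i * z ^ i)" "\<forall>i. c i \<in> F" using v by (auto simp: G_def V_def)
    obtain b where b: "w = (\<Sum>i<m. b i * z ^ i)" "\<forall>i. b i \<in> F" using w by (auto simp: G_def V_def)
    have "v * w = (\<Sum>i<m. \<Sum>j<m. (c i * b j) * z ^ (i + j))"
      unfolding c(1) b(1) sum_product by (intro sum.cong refl) (simp add: power_add mult_ac)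
    thus ?thesis using c(2) b(2) FD(4) zG Vscale[of _ _ m, folded G_def] by (auto intro!: Gsum)
  qed
  show GF: "insert z F \<subseteq> G"
    using zG[of 0] zG[of 1] Vscale[of _ 1 m, folded G_def] by auto
  show "complete_under abv G" unfolding G_def by (rule Vcomplete)
  show "is_subfield G" unfolding is_subfield_def
  proof (intro conjI ballI)
    show "0 \<in> G" "1 \<in> G" using GF FD(1,2) by auto
  next
    fix x y assume xy: "x \<in> G" "y \<in> G"
    show "x + y \<in> G" using xy Vadd unfolding G_def by blast
    show "x * y \<in> G" using xy by (rule Gmult)
  next
    fix x assume x: "x \<in> G"
    show "- x \<in> G" using Vscale[of "- 1" x m, folded G_def] x FD(2,5) by simp
    show "inverse x \<in> G"
    proof (cases "x = 0")
      case True
      thus ?thesis using V0 by (simp add: G_def)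
    next
      case False
      obtain f where f: "f \<noteq> 0" "\<forall>i. coeff f i \<in> K" "poly f x = 0" using alg by blast
      show ?thesis
        using inverse_in_subring[of G K x f] V0 Vadd Gmult K GF x False f unfolding G_def by blast
    qed
  qed
  show "G \<subseteq> H" if "is_subfield H" "insert z F \<subseteq> H" for H
  proof
    fix v assume "v \<in> G"
    then obtain c where c: "v = (\<Sum>i<m. c i * z ^ i)" "\<forall>i. c i \<in> F" by (auto simp: G_def V_def)
    show "v \<in> H" unfolding c(1)
      using c(2) that(2) is_subfieldD(4,8)[OF that(1)] by (intro is_subfield_sum[OF that(1)]) blast
  qed
qed

text \<open>Applied to L = Q_q with the radicals \<open>zeta\<close> and \<open>tpi\<close>: L is
  complete as a finite-dimensional space over K, and the two radicals are adjoined in turn.\<close>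

lemma (in nonarch) complete_field_generated:
  assumes K: "is_subfield K" "complete_under abv K"
    and alg: "\<And>x. \<exists>f. f \<noteq> 0 \<and> (\<forall>i. coeff f i \<in> K) \<and> poly f x = 0"
    and L: "is_subfield L" "K \<subseteq> L" "finite S" "basis_modulo K (*) L {0} S"
    and y: "y ^ k \<in> L" "k > 0" and z: "z ^ m \<in> L" "m > 0"
  shows "complete_under abv (field_generated (L \<union> {y, z}))"
proof -
  have S: "S \<subseteq> L" using L(4) by (simp add: basis_modulo_def)
  have "L = {(\<Sum>s\<in>S. c s * s) | c. c ` S \<subseteq> K}"
  proof (intro equalityI subsetI)
    fix x assume "x \<in> L"
    then obtain T c where T: "T \<subseteq> S" "c ` T \<subseteq> K" "x = (\<Sum>s\<in>T. c s * s)"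
      using L(4) unfolding basis_modulo_def by force
    have "x = (\<Sum>s\<in>S. (if s \<in> T then c s else 0) * s)"
      unfolding T(3) using T(1) L(3) by (intro sum.mono_neutral_cong_left) auto
    moreover have "(\<lambda>s. if s \<in> T then c s else 0) ` S \<subseteq> K"
      using T(2) is_subfieldD(1)[OF K(1)] by auto
    ultimately show "x \<in> {(\<Sum>s\<in>S. c s * s) | c. c ` S \<subseteq> K}"
      by (intro CollectI exI[of _ "\<lambda>s. if s \<in> T then c s else 0"] conjI)
  next
    fix x assume "x \<in> {(\<Sum>s\<in>S. c s * s) | c. c ` S \<subseteq> K}"
    then obtain c where c: "x = (\<Sum>s\<in>S. c s * s)" "c ` S \<subseteq> K" by blast
    show "x \<in> L" unfolding c(1)
      by (rule is_subfield_sum[OF L(1)]) (use c(2) S L(2) in \<open>auto intro!: is_subfieldD(4)[OF L(1)]\<close>)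
  qed
  hence "complete_under abv L" using complete_span[OF K L(3)] by simp
  then obtain G where G: "is_subfield G" "complete_under abv G" "insert y L \<subseteq> G"
      "\<And>H. is_subfield H \<Longrightarrow> insert y L \<subseteq> H \<Longrightarrow> G \<subseteq> H"
    using complete_adjoin_root[OF L(1) _ K(1) L(2) alg y] by blast
  have "K \<subseteq> G" "z ^ m \<in> G" using L(2) G(3) z by auto
  then obtain M where M: "is_subfield M" "complete_under abv M" "insert z G \<subseteq> M"
      "\<And>H. is_subfield H \<Longrightarrow> insert z G \<subseteq> H \<Longrightarrow> M \<subseteq> H"
    using complete_adjoin_root[OF G(1,2) K(1) _ alg _ z(2)] by blast
  let ?E = "field_generated (L \<union> {y, z})"
  have E: "is_subfield ?E" "L \<union> {y, z} \<subseteq> ?E"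
    by (rule field_generated_subfield, rule field_generated_superset)
  have "?E \<subseteq> M" using M(1,3) G(3) by (intro field_generated_subset) auto
  moreover have "M \<subseteq> ?E" using M(4)[OF E(1)] G(4)[OF E(1)] E(2) by auto
  ultimately show ?thesis using M(2) by (simp add: subset_antisym)
qed

section \<open>Reduction of exponents\<close>

text \<open>
  The operators are written in the basis \<open>e u = t ^ W u x\<^sup>u\<close>. For an additive map \<open>\<sigma>\<close>,
  \<open>D \<sigma> (e u) = \<sigma> u e u + (\<Sum>j. \<sigma> (V j) \<lambda>\<^sub>j t ^ (W u + E - W (u + V j)) e (u + V j))\<close>, and \<open>Dd \<sigma>\<close>
  is the transpose of \<open>D \<sigma>\<close>. The sets of exponents with a given value of \<open>arg\<close> are
  the cones over the facets of the polytope, made disjoint by breaking ties, and \<open>V j\<close> is the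
  vertex which does not lie on the facet \<open>j\<close>. The function \<open>W'\<close> refines \<open>W\<close>.
\<close>

locale facet_reduction = nonarch abv
  for abv :: "'k::field \<Rightarrow> real" +
  fixes K :: "'k set" and t :: 'k
    and \<tau> :: "'l::finite \<Rightarrow> 'g::ab_group_add \<Rightarrow> 'k"
    and V :: "'i::finite \<Rightarrow> 'g" and lc :: "'i \<Rightarrow> 'k"
    and W W' :: "'g \<Rightarrow> nat" and E E' :: nat
    and arg :: "'g \<Rightarrow> 'i"
    and \<rho> :: "'i \<Rightarrow> 'i \<Rightarrow> 'l \<Rightarrow> 'k" and \<rho>' :: "'i \<Rightarrow> 'l \<Rightarrow> 'i \<Rightarrow> 'k"
  assumes K: "is_subfield K" "complete_under abv K"
    and t: "t \<in> K" "abv t \<le> 1"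
    and \<tau>_add: "\<tau> l (u + v) = \<tau> l u + \<tau> l v"
    and \<tau>_int: "\<tau> l u \<in> integers_of abv K"
    and lc: "lc j \<in> K" "abv (lc j) = 1"
    and W_other: "j \<noteq> arg u \<Longrightarrow> W (u + V j) = W u + E"
    and W_le: "W (u + V j) \<le> W u + E"
    and W'_other: "j \<noteq> arg u \<Longrightarrow> W' (u + V j) = W' u + E'"
    and W'_arg: "W' (u + V (arg u)) < W' u + E'"
    and E': "E' > 0"
    and arg_other: "j \<noteq> arg u \<Longrightarrow> arg (u + V j) = arg u"
    and \<rho>: "\<rho> i k l \<in> integers_of abv K"
    and \<rho>_zero: "i \<noteq> k \<Longrightarrow> m \<noteq> i \<Longrightarrow> m \<noteq> k \<Longrightarrow> (\<Sum>l\<in>UNIV. \<rho> i k l * \<tau> l (V m)) = 0"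
    and \<rho>_unit: "i \<noteq> k \<Longrightarrow> abv (\<Sum>l\<in>UNIV. \<rho> i k l * \<tau> l (V k)) = 1"
    and \<rho>': "\<tau> l u = (\<Sum>k\<in>-{i}. \<rho>' i l k * (\<Sum>m\<in>UNIV. \<rho> i k m * \<tau> m u))"
    and finite_basis: "finite {v. \<forall>j. arg (v - V j) = j}"
begin

abbreviation R :: "'k set" where "R \<equiv> integers_of abv K"

text \<open>For i \<noteq> k this is the form that can be nonzero only on the vertices
  \<open>V i\<close> and \<open>V k\<close>, with a unit as its value at \<open>V k\<close>.\<close>

definition \<sigma> :: "'i \<Rightarrow> 'i \<Rightarrow> 'g \<Rightarrow> 'k" where
  "\<sigma> i k u = (\<Sum>l\<in>UNIV. \<rho> i k l * \<tau> l u)"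

text \<open>If u = v - V j has \<open>arg u\<close> \<noteq> j, then v is the leading exponent of
  the relation given by \<open>\<sigma> (arg u) j\<close> at u. Membership excludes this for every
  j.\<close>

definition basis :: "'g set" where
  "basis = {v. \<forall>j. arg (v - V j) = j}"

text \<open>The factor that remains when \<pi> = t^E is absorbed into the change of basis vector;
  the natural subtraction is exact by \<open>W_le\<close>.\<close>

definition s :: "'i \<Rightarrow> 'g \<Rightarrow> 'k" where
  "s j u = t ^ (W u + E - W (u + V j))"

definition D :: "('g \<Rightarrow> 'k) \<Rightarrow> ('g \<Rightarrow> 'k) \<Rightarrow> 'g \<Rightarrow> 'k" where
  "D \<omega> c w = \<omega> w * c w + (\<Sum>j\<in>UNIV. \<omega> (V j) * lc j * s j (w - V j) * c (w - V j))"

definition Dd :: "('g \<Rightarrow> 'k) \<Rightarrow> ('g \<Rightarrow> 'k) \<Rightarrow> 'g \<Rightarrow> 'k" where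
  "Dd \<omega> \<phi> u = \<omega> u * \<phi> u + (\<Sum>j\<in>UNIV. \<omega> (V j) * lc j * s j u * \<phi> (u + V j))"

lemma R_iff: "x \<in> R \<longleftrightarrow> x \<in> K \<and> abv x \<le> 1"
  by (simp add: integers_of_def)

lemma R_0: "0 \<in> R" and R_1: "1 \<in> R"
  using is_subfieldD(1,2)[OF K(1)] by (auto simp: R_iff)

lemma R_add: "x \<in> R \<Longrightarrow> y \<in> R \<Longrightarrow> x + y \<in> R"
  using is_subfieldD(3)[OF K(1)] by (auto simp: R_iff intro: abv_add_le)

lemma R_mult: "x \<in> R \<Longrightarrow> y \<in> R \<Longrightarrow> x * y \<in> R"
  using is_subfieldD(4)[OF K(1)] by (auto simp: R_iff abv_mult mult_le_one)

lemma R_minus: "x \<in> R \<Longrightarrow> - x \<in> R"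
  using is_subfieldD(5)[OF K(1)] by (auto simp: R_iff)

lemma R_sum: "(\<And>i. i \<in> A \<Longrightarrow> f i \<in> R) \<Longrightarrow> sum f A \<in> R"
  by (induction A rule: infinite_finite_induct) (auto intro: R_0 R_add)

lemma R_power: "x \<in> R \<Longrightarrow> x ^ n \<in> R"
  by (induction n) (auto intro: R_1 R_mult)

lemma lc_R: "lc j \<in> R" and s_R: "s j u \<in> R"
  using lc t R_power[of t] by (simp_all add: s_def R_iff)

lemma \<sigma>_R: "\<sigma> i k u \<in> R"
  unfolding \<sigma>_def by (intro R_sum R_mult \<rho> \<tau>_int)

lemma \<sigma>_add: "\<sigma> i k (u + v) = \<sigma> i k u + \<sigma> i k v"
  unfolding \<sigma>_def by (simp add: \<tau>_add distrib_left sum.distrib)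

lemma s_other: "j \<noteq> arg u \<Longrightarrow> s j u = 1"
  by (simp add: s_def W_other)

lemma sum_\<sigma>:
  assumes "i \<noteq> k"
  shows "(\<Sum>j\<in>UNIV. \<sigma> i k (V j) * f j) = \<sigma> i k (V i) * f i + \<sigma> i k (V k) * f k"
proof -
  have "(\<Sum>j\<in>UNIV. \<sigma> i k (V j) * f j) = (\<Sum>j\<in>{i, k}. \<sigma> i k (V j) * f j)"
    using assms \<rho>_zero[of i k] by (intro sum.mono_neutral_right) (auto simp: \<sigma>_def)
  thus ?thesis using assms by simp
qed

lemma Dd_\<sigma>:
  assumes "i \<noteq> k"
  shows "Dd (\<sigma> i k) \<phi> u = \<sigma> i k u * \<phi> u + (\<sigma> i k (V i) * lc i * s i u * \<phi> (u + V i)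
                            + \<sigma> i k (V k) * lc k * s k u * \<phi> (u + V k))"
  unfolding Dd_def using sum_\<sigma>[OF assms, of "\<lambda>j. lc j * s j u * \<phi> (u + V j)"]
  by (simp add: mult.assoc)

lemma D_lincomb: "D \<omega> (\<lambda>w. c w + r * c' w) w = D \<omega> c w + r * D \<omega> c' w"
  unfolding D_def by (simp add: algebra_simps sum.distrib sum_distrib_left)

lemma D_zero: "D \<omega> (\<lambda>w. 0) w = 0"
  unfolding D_def by simp

lemma D_cmult: "D \<omega> (\<lambda>w. r * c w) w = r * D \<omega> c w"
  using D_lincomb[of \<omega> "\<lambda>_. 0" r c w] by (simp add: D_zero)

lemma D_diff: "D \<omega> (\<lambda>w. c w - c' w) w = D \<omega> c w - D \<omega> c' w"
  using D_lincomb[of \<omega> c "- 1" c' w] by simp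

lemma D_sum_left: "D (\<lambda>u. \<Sum>l\<in>A. r l * \<omega> l u) c w = (\<Sum>l\<in>A. r l * D (\<omega> l) c w)"
proof -
  have "(\<Sum>j\<in>UNIV. (\<Sum>l\<in>A. r l * \<omega> l (V j)) * lc j * s j (w - V j) * c (w - V j)) =
        (\<Sum>l\<in>A. \<Sum>j\<in>UNIV. r l * \<omega> l (V j) * lc j * s j (w - V j) * c (w - V j))"
    by (subst sum.swap) (simp add: sum_distrib_right)
  thus ?thesis unfolding D_def
    by (simp add: distrib_left sum.distrib sum_distrib_left sum_distrib_right mult.assoc)
qed

lemma Dd_sum_left: "Dd (\<lambda>u. \<Sum>l\<in>A. r l * \<omega> l u) \<phi> u = (\<Sum>l\<in>A. r l * Dd (\<omega> l) \<phi> u)"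
proof -
  have "(\<Sum>j\<in>UNIV. (\<Sum>l\<in>A. r l * \<omega> l (V j)) * lc j * s j u * \<phi> (u + V j)) =
        (\<Sum>l\<in>A. \<Sum>j\<in>UNIV. r l * \<omega> l (V j) * lc j * s j u * \<phi> (u + V j))"
    by (subst sum.swap) (simp add: sum_distrib_right)
  thus ?thesis unfolding Dd_def
    by (simp add: distrib_left sum.distrib sum_distrib_left sum_distrib_right mult.assoc)
qed

lemma D_delta:
  "D \<omega> (\<lambda>w. if w = u then 1 else 0) w =
     (if w = u then \<omega> u else 0) + (\<Sum>j\<in>UNIV. if w = u + V j then \<omega> (V j) * lc j * s j u else 0)"
proof -
  have "w - V j = u \<longleftrightarrow> w = u + V j" for j by (metis add_diff_cancel diff_add_cancel)
  thus ?thesis unfolding D_def by (auto intro!: arg_cong2[of _ _ _ _ "(+)"] sum.cong)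
qed

text \<open>Along either path from u to u + V j + V k the exponents of t telescope to W u + 2E - W
  (u + V j + V k). Additivity of both forms makes the coefficient of \<phi> (u + V j) symmetric in
  \<omega> and \<eta>.\<close>

lemma Dd_commute:
  assumes \<omega>: "\<And>u v. \<omega> (u + v) = \<omega> u + \<omega> v" and \<eta>: "\<And>u v. \<eta> (u + v) = \<eta> u + \<eta> v"
  shows "Dd \<omega> (Dd \<eta> \<phi>) u = Dd \<eta> (Dd \<omega> \<phi>) u"
proof -
  have ss: "s j u * s k (u + V j) = s k u * s j (u + V k)" for j k
  proof -
    have "W u + E - W (u + V j) + (W (u + V j) + E - W (u + V j + V k)) =
          W u + E - W (u + V k) + (W (u + V k) + E - W (u + V k + V j))"
      using W_le[of u j] W_le[of u k] W_le[of "u + V j" k] W_le[of "u + V k" j]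
      by (simp add: add_ac)
    thus ?thesis unfolding s_def by (simp flip: power_add)
  qed
  have expand: "Dd \<omega> (Dd \<eta> \<phi>) u = \<omega> u * \<eta> u * \<phi> u
      + (\<Sum>j\<in>UNIV. (\<omega> u * \<eta> (V j) + \<eta> u * \<omega> (V j) + \<omega> (V j) * \<eta> (V j)) * (lc j * s j u * \<phi> (u + V j)))
      + (\<Sum>j\<in>UNIV. \<Sum>k\<in>UNIV. \<omega> (V j) * \<eta> (V k) * (lc j * lc k * (s j u * s k (u + V j)) * \<phi> (u + V j + V k)))"
    if \<eta>: "\<And>u v. \<eta> (u + v) = \<eta> u + \<eta> v" for \<omega> \<eta> :: "'g \<Rightarrow> 'k"
    unfolding Dd_def by (simp add: \<eta> algebra_simps sum.distrib sum_distrib_left)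
  have "(\<Sum>j\<in>UNIV. \<Sum>k\<in>UNIV. \<omega> (V j) * \<eta> (V k) * (lc j * lc k * (s j u * s k (u + V j)) * \<phi> (u + V j + V k))) =
        (\<Sum>k\<in>UNIV. \<Sum>j\<in>UNIV. \<omega> (V j) * \<eta> (V k) * (lc j * lc k * (s j u * s k (u + V j)) * \<phi> (u + V j + V k)))"
    by (rule sum.swap)
  also have "\<dots> = (\<Sum>k\<in>UNIV. \<Sum>j\<in>UNIV. \<eta> (V k) * \<omega> (V j) * (lc k * lc j * (s k u * s j (u + V k)) * \<phi> (u + V k + V j)))"
    by (intro sum.cong refl) (simp add: ss add_ac mult_ac)
  finally show ?thesis unfolding expand[of \<eta> \<omega>, OF \<eta>] expand[of \<omega> \<eta>, OF \<omega>]
    by (simp add: algebra_simps)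
qed

text \<open>The finite support of each \<open>g l\<close> is recorded because infinite combinations
  of such reductions are formed later and must again have coefficients tending to 0.\<close>

definition reducible :: "('g \<Rightarrow> 'k) \<Rightarrow> bool" where
  "reducible f \<longleftrightarrow> (\<exists>\<beta> g. (\<forall>w. \<beta> w \<in> R) \<and> (\<forall>w. w \<notin> basis \<longrightarrow> \<beta> w = 0) \<and>
     (\<forall>l w. g l w \<in> R) \<and> (\<forall>l. finite {w. g l w \<noteq> 0}) \<and>
     (\<forall>w. f w = \<beta> w + (\<Sum>l\<in>UNIV. D (\<tau> l) (g l) w)))"

lemma reducible_lincomb:
  assumes f: "reducible f" and h: "reducible h" and r: "r \<in> R"
  shows "reducible (\<lambda>w. f w + r * h w)"
proof -
  from f obtain \<beta> g where 1: "\<And>w. \<beta> w \<in> R" "\<And>w. w \<notin> basis \<Longrightarrow> \<beta> w = 0"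
      "\<And>l w. g l w \<in> R" "\<And>l. finite {w. g l w \<noteq> 0}"
      "\<And>w. f w = \<beta> w + (\<Sum>l\<in>UNIV. D (\<tau> l) (g l) w)"
    unfolding reducible_def by blast
  from h obtain \<beta>' g' where 2: "\<And>w. \<beta>' w \<in> R" "\<And>w. w \<notin> basis \<Longrightarrow> \<beta>' w = 0"
      "\<And>l w. g' l w \<in> R" "\<And>l. finite {w. g' l w \<noteq> 0}"
      "\<And>w. h w = \<beta>' w + (\<Sum>l\<in>UNIV. D (\<tau> l) (g' l) w)"
    unfolding reducible_def by blast
  show ?thesis unfolding reducible_def
  proof (intro exI conjI allI impI)
    show "\<beta> w + r * \<beta>' w \<in> R" "g l w + r * g' l w \<in> R" for l w
      by (intro R_add R_mult 1 2 r)+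
    show "\<beta> w + r * \<beta>' w = 0" if "w \<notin> basis" for w
      using 1(2) 2(2) that by simp
    show "finite {w. g l w + r * g' l w \<noteq> 0}" for l
      by (rule finite_subset[OF _ finite_UnI[OF 1(4)[of l] 2(4)[of l]]]) auto
    show "f w + r * h w = (\<beta> w + r * \<beta>' w) + (\<Sum>l\<in>UNIV. D (\<tau> l) (\<lambda>w. g l w + r * g' l w) w)" for w
      by (simp add: 1(5) 2(5) D_lincomb sum.distrib sum_distrib_left distrib_left)
  qed
qed

lemma reducible_D:
  assumes "\<And>l. r l \<in> R" "\<And>w. c w \<in> R" "finite {w. c w \<noteq> 0}"
  shows "reducible (D (\<lambda>u. \<Sum>l\<in>UNIV. r l * \<tau> l u) c)"
  unfolding reducible_def
proof (intro exI conjI allI impI)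
  show "(0::'k) \<in> R" by (rule R_0)
  show "r l * c w \<in> R" for l w by (intro R_mult assms)
  show "finite {w. r l * c w \<noteq> 0}" for l by (rule finite_subset[OF _ assms(3)]) auto
  show "D (\<lambda>u. \<Sum>l\<in>UNIV. r l * \<tau> l u) c w = 0 + (\<Sum>l\<in>UNIV. D (\<tau> l) (\<lambda>w. r l * c w) w)" for w
    by (simp add: D_sum_left D_cmult)
qed simp

lemma unit_inverse_R: "x \<in> R \<Longrightarrow> abv x = 1 \<Longrightarrow> inverse x \<in> R"
  using is_subfieldD(6)[OF K(1)] by (simp add: R_iff abv_inverse)

lemma W'_lead:
  assumes "arg (v - V j) \<noteq> j"
  shows "W' v = W' (v - V j) + E'" "W' (v - V j + V (arg (v - V j))) < W' v"
  using W'_other[of j "v - V j"] W'_arg[of "v - V j"] assms by auto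

lemma reducible_delta: "reducible (\<lambda>w. if w = v then 1 else 0)"
proof (induction "W' v" arbitrary: v rule: less_induct)
  case less
  show ?case
  proof (cases "v \<in> basis")
    case True
    show ?thesis unfolding reducible_def
    proof (intro exI conjI allI impI)
      show "(if w = v then 1 else 0) =
          (if w = v then 1 else 0) + (\<Sum>l\<in>UNIV. D (\<tau> l) ((\<lambda>_ _. 0) l) w)" for w
        by (simp add: D_zero)
    qed (use True R_0 R_1 in auto)
  next
    case False
    then obtain j where j: "arg (v - V j) \<noteq> j" by (auto simp: basis_def)
    define u where "u = v - V j"
    define i where "i = arg u"
    have v: "v = u + V j" and ij: "i \<noteq> j" using j by (auto simp: u_def i_def)
    define b where "b = \<sigma> i j (V j) * lc j"
    have b: "b \<in> R" "abv b = 1"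
      using \<rho>_unit[OF ij] lc R_mult[OF \<sigma>_R lc_R] by (auto simp: b_def \<sigma>_def abv_mult)
    hence b0: "b \<noteq> 0" by auto
    have binv: "inverse b \<in> R" by (rule unit_inverse_R[OF b])
    have 1: "reducible (\<lambda>w. if w = u then 1 else 0)" "reducible (\<lambda>w. if w = u + V i then 1 else 0)"
      using W'_lead[OF j] E' by (auto intro!: less simp: u_def i_def)
    let ?D = "D (\<sigma> i j) (\<lambda>w. if w = u then 1 else 0)"
    have 2: "reducible ?D" unfolding \<sigma>_def[abs_def]
      by (rule reducible_D) (auto intro: \<rho> R_0 R_1)
    have sj: "s j u = 1" using ij by (intro s_other) (simp add: i_def)
    have Deq: "?D w = \<sigma> i j u * (if w = u then 1 else 0) +
        \<sigma> i j (V i) * lc i * s i u * (if w = u + V i then 1 else 0) + b * (if w = v then 1 else 0)" for w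
      unfolding D_delta
      using sum_\<sigma>[OF ij, of "\<lambda>j. if w = u + V j then lc j * s j u else 0"] sj
      by (simp add: v b_def if_distrib[of "\<lambda>x. _ * x"] mult.assoc cong: if_cong)
    have zero: "reducible (\<lambda>w. 0)"
      using reducible_lincomb[OF 1(1) 1(1), of "- 1"] R_minus[OF R_1] by simp
    \<comment> \<open>The relation \<open>Deq\<close> is divided by its unit pivot b and solved for
      the exponent v.\<close>
    have "reducible (\<lambda>w. (0 + inverse b * ?D w) + (- (inverse b * \<sigma> i j u)) * (if w = u then 1 else 0)
        + (- (inverse b * (\<sigma> i j (V i) * lc i * s i u))) * (if w = u + V i then 1 else 0))"
      by (intro reducible_lincomb zero 1 2 binv R_minus R_mult \<sigma>_R lc_R s_R)
    also have "(\<lambda>w. (0 + inverse b * ?D w) + (- (inverse b * \<sigma> i j u)) * (if w = u then 1 else 0)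
        + (- (inverse b * (\<sigma> i j (V i) * lc i * s i u))) * (if w = u + V i then 1 else 0))
        = (\<lambda>w. if w = v then 1 else 0)"
    proof
      fix w
      have "inverse b * (b * x) = x" for x using b0 by (simp flip: mult.assoc)
      thus "(0 + inverse b * ?D w) + (- (inverse b * \<sigma> i j u)) * (if w = u then 1 else 0)
        + (- (inverse b * (\<sigma> i j (V i) * lc i * s i u))) * (if w = u + V i then 1 else 0)
        = (if w = v then 1 else 0)"
        unfolding Deq by (simp add: algebra_simps)
    qed
    finally show ?thesis .
  qed
qed

definition null :: "('g \<Rightarrow> 'k) \<Rightarrow> bool" where
  "null c \<longleftrightarrow> (\<forall>e>0. finite {u. e \<le> abv (c u)})"

lemma has_abv_sum_exists_R:
  assumes "\<And>i::'g. f i \<in> R" "null f"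
  shows "\<exists>x\<in>R. has_abv_sum f x"
proof -
  obtain x where x: "x \<in> K" "has_abv_sum f x"
    using has_abv_sum_exists[OF K(2) is_subfieldD(1,3)[OF K(1)], of f] assms
    by (auto simp: R_iff null_def)
  have "abv x \<le> 1" using has_abv_sum_le[OF x(2), of 1] assms(1) by (simp add: R_iff)
  thus ?thesis using x by (auto simp: R_iff)
qed

lemma null_mult:
  assumes "null c" "\<And>u. f u \<in> R"
  shows "null (\<lambda>u. c u * f u)"
  unfolding null_def
proof (intro allI impI)
  fix e :: real assume "e > 0"
  hence "finite {u. e \<le> abv (c u)}" using assms(1) by (simp add: null_def)
  moreover have "abv (c u * f u) \<le> abv (c u)" for u
    using assms(2)[of u] mult_left_mono[of "abv (f u)" 1 "abv (c u)"] by (simp add: abv_mult R_iff)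
  ultimately show "finite {u. e \<le> abv (c u * f u)}"
    by (elim finite_subset[rotated]) (auto intro: order_trans)
qed

text \<open>The finite reductions of the single exponents v are superposed with the coefficients c
  v. The sums converge coefficientwise because c tends to 0 and the reductions are integral. They
  commute with the operators because a coefficient of D involves only finitely many coefficients of
  its argument.\<close>

theorem generation:
  assumes c: "\<And>u. c u \<in> R" "null c"
  obtains \<beta> g where "\<And>w. \<beta> w \<in> R" "\<And>w. w \<notin> basis \<Longrightarrow> \<beta> w = 0" "\<And>l w. g l w \<in> R" "\<And>l. null (g l)"
    "\<And>w. c w = \<beta> w + (\<Sum>l\<in>UNIV. D (\<tau> l) (g l) w)"
proof -
  define P where "P v \<beta> g \<longleftrightarrow> (\<forall>w. \<beta> w \<in> R) \<and> (\<forall>w. w \<notin> basis \<longrightarrow> \<beta> w = 0) \<and>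
     (\<forall>l w. g l w \<in> R) \<and> (\<forall>l. finite {w. g l w \<noteq> 0}) \<and>
     (\<forall>w. (if w = v then 1 else 0) = \<beta> w + (\<Sum>l\<in>UNIV. D (\<tau> l) (g l) w))" for v \<beta> g
  have "\<forall>v. \<exists>\<beta> g. P v \<beta> g"
    using reducible_delta unfolding reducible_def P_def by blast
  then obtain b h where bh: "\<And>v. P v (b v) (h v)" by metis
  have b: "\<And>v w. b v w \<in> R" "\<And>v w. w \<notin> basis \<Longrightarrow> b v w = 0"
    and h: "\<And>v l w. h v l w \<in> R" "\<And>v l. finite {w. h v l w \<noteq> 0}"
    and eq: "\<And>v w. (if w = v then 1 else 0) = b v w + (\<Sum>l\<in>UNIV. D (\<tau> l) (h v l) w)"
    using bh unfolding P_def by blast+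
  have "\<exists>x\<in>R. has_abv_sum (\<lambda>v. c v * b v w) x" for w
    by (intro has_abv_sum_exists_R null_mult R_mult b c)
  then obtain \<beta> where \<beta>: "\<And>w. \<beta> w \<in> R" "\<And>w. has_abv_sum (\<lambda>v. c v * b v w) (\<beta> w)" by metis
  have "\<exists>x\<in>R. has_abv_sum (\<lambda>v. c v * h v l w) x" for l w
    by (intro has_abv_sum_exists_R null_mult R_mult h c)
  then obtain g where g: "\<And>l w. g l w \<in> R" "\<And>l w. has_abv_sum (\<lambda>v. c v * h v l w) (g l w)" by metis
  show thesis
  proof (rule that[of \<beta> g])
    show "\<beta> w = 0" if "w \<notin> basis" for w
    proof -
      have "has_abv_sum (\<lambda>v::'g. 0) 0" using has_abv_sum_single[of undefined 0] by simp
      thus ?thesis using \<beta>(2)[of w] b(2)[OF that] has_abv_sum_unique by simp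
    qed
    show "null (g l)" for l
      unfolding null_def
    proof (intro allI impI)
      fix e :: real assume e: "e > 0"
      \<comment> \<open>Half of e is used because the limit inherits only a weak inequality from its
        terms. Outside the finitely many finite supports of \<open>h v l\<close> with v in
        \<open>?F\<close>, the sum is at most e/2 < e.\<close>
      let ?F = "{v. e / 2 \<le> abv (c v)}"
      have "finite ?F" using c(2) half_gt_zero[OF e] unfolding null_def by blast
      hence fin: "finite (\<Union>v\<in>?F. {w. h v l w \<noteq> 0})" using h(2) by blast
      have "abv (g l w) \<le> e / 2" if w: "w \<notin> (\<Union>v\<in>?F. {w. h v l w \<noteq> 0})" for w
      proof (rule has_abv_sum_le[OF g(2)])
        fix v
        show "abv (c v * h v l w) \<le> e / 2"
        proof (cases "v \<in> ?F")
          case True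
          thus ?thesis using w e by auto
        next
          case False
          thus ?thesis using h(1)[of v l w] mult_left_mono[of "abv (h v l w)" 1 "abv (c v)"]
            by (simp add: abv_mult R_iff)
        qed
      qed (use e in simp)
      hence "{w. e \<le> abv (g l w)} \<subseteq> (\<Union>v\<in>?F. {w. h v l w \<noteq> 0})" using e by force
      thus "finite {w. e \<le> abv (g l w)}" using fin finite_subset by blast
    qed
    show "c w = \<beta> w + (\<Sum>l\<in>UNIV. D (\<tau> l) (g l) w)" for w
    proof -
      have 1: "has_abv_sum (\<lambda>v. a * (c v * h v l w')) (a * g l w')" for a l w'
        by (rule has_abv_sum_cmult[OF g(2)])
      have "has_abv_sum (\<lambda>v. c v * b v w + (\<Sum>l\<in>UNIV. \<tau> l w * (c v * h v l w)
          + (\<Sum>j\<in>UNIV. \<tau> l (V j) * lc j * s j (w - V j) * (c v * h v l (w - V j)))))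
          (\<beta> w + (\<Sum>l\<in>UNIV. D (\<tau> l) (g l) w))"
        unfolding D_def by (intro has_abv_sum_add \<beta>(2) has_abv_sum_finite_sum 1) simp_all
      also have "(\<lambda>v. c v * b v w + (\<Sum>l\<in>UNIV. \<tau> l w * (c v * h v l w)
          + (\<Sum>j\<in>UNIV. \<tau> l (V j) * lc j * s j (w - V j) * (c v * h v l (w - V j)))))
          = (\<lambda>v. c v * (b v w + (\<Sum>l\<in>UNIV. D (\<tau> l) (h v l) w)))"
        unfolding D_def by (simp add: algebra_simps sum_distrib_left)
      also have "\<dots> = (\<lambda>v. if v = w then c w else 0)"
        by (auto simp flip: eq)
      finally have "has_abv_sum (\<lambda>v. if v = w then c w else 0) (\<beta> w + (\<Sum>l\<in>UNIV. D (\<tau> l) (g l) w))" .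
      thus ?thesis by (rule has_abv_sum_unique[OF has_abv_sum_single])
    qed
  qed (use \<beta> g in auto)
qed

section \<open>Dual functionals and linear independence\<close>

text \<open>
  The value of a dual functional at an exponent outside the basis is forced by any one of the
  relations with this leading exponent. That all of them give the same value follows from the
  fact that the operators commute.
\<close>

theorem dual_functional:
  assumes y: "\<And>v. y v \<in> R"
  obtains \<phi> where "\<And>v. \<phi> v \<in> R" "\<And>v. v \<in> basis \<Longrightarrow> \<phi> v = y v" "\<And>l u. Dd (\<tau> l) \<phi> u = 0"
proof -
  define jj where "jj v = (SOME j. arg (v - V j) \<noteq> j)" for v
  have jj: "arg (v - V (jj v)) \<noteq> jj v" if "v \<notin> basis" for v
    using that someI_ex[of "\<lambda>j. arg (v - V j) \<noteq> j"] unfolding jj_def basis_def by blast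
  define ii where "ii v = arg (v - V (jj v))" for v
  define c where "c v = \<sigma> (ii v) (jj v) (V (jj v)) * lc (jj v)" for v
  \<comment> \<open>Outside the basis, \<phi> v is found by solving the chosen relation at v - V (jj
    v) for its leading term. Both other arguments have smaller refined weight, so the recursion is
    well-founded.\<close>
  define F where "F \<phi> v = (if v \<in> basis then y v else
      - inverse (c v) * (\<sigma> (ii v) (jj v) (v - V (jj v)) * \<phi> (v - V (jj v))
        + \<sigma> (ii v) (jj v) (V (ii v)) * lc (ii v) * s (ii v) (v - V (jj v)) * \<phi> (v - V (jj v) + V (ii v))))"
    for \<phi> v
  define \<phi> where "\<phi> = wfrec (inv_image less_than W') F"
  have less: "W' (v - V (jj v)) < W' v" "W' (v - V (jj v) + V (ii v)) < W' v" if "v \<notin> basis" for v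
    using W'_lead[OF jj[OF that]] E' by (auto simp: ii_def)
  have \<phi>: "\<phi> v = F \<phi> v" for v
  proof -
    have "\<phi> v = F (cut \<phi> (inv_image less_than W') v) v"
      unfolding \<phi>_def by (rule wfrec) auto
    also have "\<dots> = F \<phi> v"
      using less[of v] by (auto simp: F_def cut_apply)
    finally show ?thesis .
  qed
  have c: "c v \<in> R" "abv (c v) = 1" if "v \<notin> basis" for v
    using \<rho>_unit[of "ii v" "jj v"] jj[OF that] lc R_mult[OF \<sigma>_R lc_R]
    by (auto simp: c_def \<sigma>_def abv_mult ii_def)
  have \<phi>_R: "\<phi> v \<in> R" for v
  proof (induction "W' v" arbitrary: v rule: less_induct)
    case less
    show ?case
    proof (cases "v \<in> basis")
      case True
      thus ?thesis using y by (simp add: \<phi> F_def)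
    next
      case False
      have "inverse (c v) \<in> R" using unit_inverse_R c False by blast
      thus ?thesis using False less \<open>v \<notin> basis \<Longrightarrow> W' (v - V (jj v)) < W' v\<close>
          \<open>v \<notin> basis \<Longrightarrow> W' (v - V (jj v) + V (ii v)) < W' v\<close>
        by (subst \<phi>) (auto simp: F_def simp del: mult_minus_left intro!: R_mult R_minus R_add \<sigma>_R lc_R s_R)
    qed
  qed
  have chosen: "Dd (\<sigma> (ii v) (jj v)) \<phi> (v - V (jj v)) = 0" if "v \<notin> basis" for v
  proof -
    have ne: "ii v \<noteq> jj v" using jj[OF that] by (simp add: ii_def)
    have "s (jj v) (v - V (jj v)) = 1" using ne by (intro s_other) (simp add: ii_def)
    moreover have "c v \<noteq> 0" using c[OF that] by auto
    hence "c v * \<phi> v = - (\<sigma> (ii v) (jj v) (v - V (jj v)) * \<phi> (v - V (jj v))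
        + \<sigma> (ii v) (jj v) (V (ii v)) * lc (ii v) * s (ii v) (v - V (jj v)) * \<phi> (v - V (jj v) + V (ii v)))"
      using that by (subst \<phi>) (simp add: F_def flip: mult.assoc)
    ultimately show ?thesis
      unfolding Dd_\<sigma>[OF ne] by (simp add: c_def)
  qed
  have Dd_\<sigma>_zero: "Dd (\<sigma> i k) \<phi> u = 0" if "\<And>l. Dd (\<tau> l) \<phi> u = 0" for i k u
    unfolding \<sigma>_def[abs_def] Dd_sum_left using that by simp
  have "Dd (\<tau> l) \<phi> u0 = 0" for l u0
  proof (induction "W' u0" arbitrary: u0 l rule: less_induct)
    case less
    define i where "i = arg u0"
    have *: "Dd (\<sigma> i k) \<phi> u0 = 0" if k: "k \<noteq> i" for k
    proof -
      define v where "v = u0 + V k"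
      have v: "v \<notin> basis" using k by (auto simp: basis_def v_def i_def intro!: exI[of _ k])
      define j where "j = jj v"
      show ?thesis
      proof (cases "j = k")
        case True
        hence "jj v = k" "v - V k = u0" by (auto simp: j_def v_def)
        thus ?thesis using chosen[OF v] by (simp add: ii_def i_def)
      next
        case False
        \<comment> \<open>The wanted relation starts at v - V k = u0, the chosen one at v - V j.
          Their common predecessor u lies in the same cone i as both: by \<open>arg_other\<close>,
          neither j nor k can be \<open>arg u\<close>.\<close>
        define u where "u = v - V j - V k"
        have uj: "u + V j = u0" and uk: "u + V k = v - V j" by (auto simp: u_def v_def)
        have "arg u \<noteq> k" using arg_other[of j u] False k uj by (auto simp: i_def)
        moreover have "arg u \<noteq> j" using arg_other[of k u] False jj[OF v] uk by (auto simp: j_def)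
        ultimately have i: "arg u = i" "i \<noteq> j" "ii v = i"
          using arg_other[of j u] arg_other[of k u] uj uk by (auto simp: i_def ii_def j_def)
        have w: "W' u < W' u0" "W' (u + V i) < W' u0"
          using W'_other[of j u] W'_arg[of u] i E' uj by auto
        have 0: "Dd (\<sigma> i m) \<phi> u = 0" "Dd (\<sigma> i m) \<phi> (u + V i) = 0" for m
          using less w by (auto intro!: Dd_\<sigma>_zero)
        have "Dd (\<sigma> i j) \<phi> (u + V k) = 0" using chosen[OF v] i by (simp add: uk j_def)
        \<comment> \<open>The inner values needed here are those at u and u + V i, zero by
          induction, and at u + V k, zero by the choice of j. After commuting, only the value of Dd
          (\<sigma> i k) \<phi> at u + V j = u0 survives, with a unit coefficient.\<close>
        hence "Dd (\<sigma> i k) (Dd (\<sigma> i j) \<phi>) u = 0"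
          using Dd_\<sigma>[of i k "Dd (\<sigma> i j) \<phi>"] k 0 by simp
        hence "Dd (\<sigma> i j) (Dd (\<sigma> i k) \<phi>) u = 0"
          using Dd_commute[of "\<sigma> i j" "\<sigma> i k"] \<sigma>_add by simp
        hence "\<sigma> i j (V j) * lc j * s j u * Dd (\<sigma> i k) \<phi> u0 = 0"
          using Dd_\<sigma>[OF i(2), of "Dd (\<sigma> i k) \<phi>"] 0 uj by simp
        moreover have "\<sigma> i j (V j) \<noteq> 0" "lc j \<noteq> 0" "s j u = 1"
          using \<rho>_unit[OF i(2)] lc(2)[of j] s_other[of j u] i by (auto simp: \<sigma>_def)
        ultimately show ?thesis by simp
      qed
    qed
    have "\<tau> l = (\<lambda>u. \<Sum>k\<in>-{i}. \<rho>' i l k * \<sigma> i k u)"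
      unfolding \<sigma>_def by (rule ext, rule \<rho>')
    hence "Dd (\<tau> l) \<phi> u0 = (\<Sum>k\<in>-{i}. \<rho>' i l k * Dd (\<sigma> i k) \<phi> u0)"
      by (simp add: Dd_sum_left)
    thus ?case using * by simp
  qed
  thus thesis using that[of \<phi>] \<phi>_R by (simp add: \<phi> F_def)
qed

text \<open>The transposition identity for a finitely supported c. S contains the shifts of the
  support by all vertices, so that no term of D is cut off.\<close>

lemma pairing:
  assumes "finite S" and F: "F \<subseteq> S" "\<And>j u. u \<in> F \<Longrightarrow> u + V j \<in> S" and c: "\<And>u. u \<notin> F \<Longrightarrow> c u = 0"
  shows "(\<Sum>w\<in>S. \<phi> w * D \<omega> c w) = (\<Sum>u\<in>F. Dd \<omega> \<phi> u * c u)"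
proof -
  have fin: "finite F" using assms(1) F(1) finite_subset by blast
  have 1: "(\<Sum>w\<in>S. \<phi> w * (\<omega> w * c w)) = (\<Sum>u\<in>F. \<omega> u * \<phi> u * c u)"
    using assms(1) F(1) c by (intro sum.mono_neutral_cong_right) auto
  have 2: "(\<Sum>w\<in>S. \<phi> w * (\<omega> (V j) * lc j * s j (w - V j) * c (w - V j))) =
      (\<Sum>u\<in>F. \<omega> (V j) * lc j * s j u * \<phi> (u + V j) * c u)" for j
  proof -
    have "(\<Sum>w\<in>S. \<phi> w * (\<omega> (V j) * lc j * s j (w - V j) * c (w - V j))) =
        (\<Sum>w\<in>(\<lambda>u. u + V j) ` F. \<phi> w * (\<omega> (V j) * lc j * s j (w - V j) * c (w - V j)))"
    proof (intro sum.mono_neutral_right ballI)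
      fix w assume "w \<in> S - (\<lambda>u. u + V j) ` F"
      hence "w - V j \<notin> F" by (metis DiffD2 diff_add_cancel image_eqI)
      thus "\<phi> w * (\<omega> (V j) * lc j * s j (w - V j) * c (w - V j)) = 0" using c by simp
    qed (use assms(1) F in auto)
    also have "\<dots> = (\<Sum>u\<in>F. \<omega> (V j) * lc j * s j u * \<phi> (u + V j) * c u)"
      by (subst sum.reindex) (auto simp: inj_on_def mult_ac intro!: sum.cong)
    finally show ?thesis .
  qed
  have "(\<Sum>w\<in>S. \<phi> w * D \<omega> c w) = (\<Sum>w\<in>S. \<phi> w * (\<omega> w * c w)) +
      (\<Sum>j\<in>UNIV. \<Sum>w\<in>S. \<phi> w * (\<omega> (V j) * lc j * s j (w - V j) * c (w - V j)))"
    by (subst sum.swap) (simp add: D_def distrib_left sum.distrib sum_distrib_left)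
  also have "\<dots> = (\<Sum>u\<in>F. \<omega> u * \<phi> u * c u) +
      (\<Sum>u\<in>F. \<Sum>j\<in>UNIV. \<omega> (V j) * lc j * s j u * \<phi> (u + V j) * c u)"
    unfolding 1 2 by (subst sum.swap) simp
  also have "\<dots> = (\<Sum>u\<in>F. Dd \<omega> \<phi> u * c u)"
    by (simp add: Dd_def distrib_right sum.distrib sum_distrib_right)
  finally show ?thesis .
qed

lemma abv_mult_R_le: "x \<in> R \<Longrightarrow> abv y \<le> e \<Longrightarrow> abv (x * y) \<le> e"
  using mult_mono[of "abv x" 1 "abv y" e] by (simp add: abv_mult R_iff)

lemma abv_D_le:
  assumes "\<And>w. abv (c w) \<le> e" "0 \<le> e"
  shows "abv (D (\<tau> l) c w) \<le> e"
  unfolding D_def using assms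
  by (intro abv_add_le abv_sum_le abv_mult_R_le R_mult \<tau>_int lc_R s_R)

theorem independence:
  assumes \<beta>: "\<And>w. w \<notin> basis \<Longrightarrow> \<beta> w = 0"
    and g: "\<And>l. null (g l)"
    and eq: "\<And>w. \<beta> w = (\<Sum>l\<in>UNIV. D (\<tau> l) (g l) w)"
  shows "\<beta> b = 0"
proof (cases "b \<in> basis")
  case b: True
  have "(if v = b then 1 else 0) \<in> R" for v using R_0 R_1 by simp
  then obtain \<phi> where \<phi>: "\<And>v. \<phi> v \<in> R" "\<And>v. v \<in> basis \<Longrightarrow> \<phi> v = (if v = b then 1 else 0)"
    "\<And>l u. Dd (\<tau> l) \<phi> u = 0"
    by (rule dual_functional[of "\<lambda>v. if v = b then 1 else 0"]) blast
  have "abv (\<beta> b) \<le> e" if e: "e > 0" for e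
  proof -
    \<comment> \<open>F holds the finitely many exponents at which some \<open>g l\<close> has size
      at least e, and \<open>h\<close> is the truncation of g to F. The truncation pairs to 0 with
      \<phi>, while the remainder contributes at most e to \<beta> b.\<close>
    define F where "F = (\<Union>l. {u. e \<le> abv (g l u)})"
    define S where "S = insert b (F \<union> (\<Union>j. (\<lambda>u. u + V j) ` F) \<union> basis)"
    define h where "h l u = (if u \<in> F then g l u else 0)" for l u
    have F: "finite F" using g e by (auto simp: F_def null_def)
    have S: "finite S" using F finite_basis by (auto simp: S_def basis_def)
    have "(\<Sum>w\<in>S. \<phi> w * D (\<tau> l) (h l) w) = (\<Sum>u\<in>F. Dd (\<tau> l) \<phi> u * h l u)" for l
      using S by (intro pairing) (auto simp: S_def h_def)
    hence 0: "(\<Sum>w\<in>S. \<phi> w * D (\<tau> l) (h l) w) = 0" for l by (simp add: \<phi>(3))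
    have "\<phi> w * \<beta> w = 0" if "w \<noteq> b" for w
      using that \<beta>[of w] \<phi>(2)[of w] by (cases "w \<in> basis") auto
    hence "(\<Sum>w\<in>S. \<phi> w * \<beta> w) = (\<Sum>w\<in>{b}. \<phi> w * \<beta> w)"
      using S by (intro sum.mono_neutral_right) (auto simp: S_def)
    hence "\<beta> b = (\<Sum>w\<in>S. \<phi> w * \<beta> w)" using b \<phi>(2) by simp
    also have "\<dots> = (\<Sum>w\<in>S. \<phi> w * \<beta> w) - (\<Sum>l\<in>UNIV. \<Sum>w\<in>S. \<phi> w * D (\<tau> l) (h l) w)"
      by (simp add: 0)
    also have "\<dots> = (\<Sum>w\<in>S. \<phi> w * (\<Sum>l\<in>UNIV. D (\<tau> l) (\<lambda>u. g l u - h l u) w))"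
      by (subst sum.swap) (simp add: eq D_diff sum_subtractf right_diff_distrib sum_distrib_left)
    also have "abv \<dots> \<le> e"
      using e by (intro abv_sum_le abv_mult_R_le \<phi> abv_D_le) (auto simp: h_def F_def not_le less_imp_le)
    finally show ?thesis .
  qed
  hence "abv (\<beta> b) \<le> 0" using field_le_epsilon[of "abv (\<beta> b)" 0] by simp
  thus ?thesis using abv_pos[of "\<beta> b"] by fastforce
qed (use \<beta> in blast)

end

section \<open>The weight function\<close>

lemma sum_option: "(\<Sum>j\<in>UNIV. f j) = f None + (\<Sum>i\<in>UNIV. f (Some i))"
  for f :: "'a::finite option \<Rightarrow> 'b::comm_monoid_add"
  unfolding UNIV_option_conv by (subst sum.insert) (auto simp: sum.reindex)

text \<open>
  The facets and the vertices other than \<open>0\<close> of the simplex are indexed by \<open>'n option\<close>: the facet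
  \<open>k\<close> is the one which does not contain the vertex \<open>k\<close>, where the vertex \<open>None\<close> is the exponent
  of the product, and \<open>facet k\<close> is the linear form with value 1 on it.
\<close>

locale exponents =
  fixes a d :: "'n::{finite, linorder} \<Rightarrow> nat"
  assumes a_pos: "a i > 0" and d_pos: "d i > 0"
begin

definition vertex :: "'n option \<Rightarrow> (int, 'n) vec" where
  "vertex j = (case j of None \<Rightarrow> expG d | Some i \<Rightarrow> expA a i)"

definition \<kappa> :: real where
  "\<kappa> = 1 + (\<Sum>j\<in>UNIV. real (d j) / real (a j))"

text \<open>The sum of y_j/a_j is 1 at every \<open>expA a j\<close> and 1 - \<kappa> at
  \<open>expG d\<close>. Subtracting \<kappa> y_i/d_i lifts the value at \<open>expG d\<close> to 1
  and otherwise changes only the value at \<open>expA a i\<close>.\<close>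

definition facet :: "'n option \<Rightarrow> (real, 'n) vec \<Rightarrow> real" where
  "facet k y = (\<Sum>j\<in>UNIV. y $ j / real (a j)) -
     (case k of None \<Rightarrow> 0 | Some i \<Rightarrow> y $ i / real (d i) * \<kappa>)"

text \<open>The amount by which \<open>facet k\<close> falls short of 1 at the opposite vertex
  k.\<close>

definition \<delta> :: "'n option \<Rightarrow> real" where
  "\<delta> k = (case k of None \<Rightarrow> \<kappa> | Some i \<Rightarrow> real (a i) / real (d i) * \<kappa>)"

definition L :: "'n option \<Rightarrow> (int, 'n) vec \<Rightarrow> real" where
  "L k v = facet k (real_vec v)"

text \<open>The coordinates in their given order, then \<open>None\<close>. This order is dictated
  by the places of the strict and weak inequalities in \<open>setB\<close>.\<close>

definition rank :: "'n option \<Rightarrow> nat" where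
  "rank k = (case k of None \<Rightarrow> CARD('n) | Some i \<Rightarrow> card {j. j < i})"

definition beats :: "(int, 'n) vec \<Rightarrow> 'n option \<Rightarrow> 'n option \<Rightarrow> bool" where
  "beats v k j \<longleftrightarrow> L j v < L k v \<or> L j v = L k v \<and> rank k < rank j"

definition arg :: "(int, 'n) vec \<Rightarrow> 'n option" where
  "arg v = (SOME k. \<forall>j. j \<noteq> k \<longrightarrow> beats v k j)"

lemma a_neq_0 [simp]: "a i \<noteq> 0" and d_neq_0 [simp]: "d i \<noteq> 0"
  using a_pos[of i] d_pos[of i] by auto

lemma \<kappa>_pos: "\<kappa> > 0"
  unfolding \<kappa>_def by (intro add_pos_nonneg sum_nonneg) auto

lemma \<delta>_pos: "\<delta> k > 0"
  using \<kappa>_pos a_pos d_pos by (auto simp: \<delta>_def split: option.split)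

lemma facet_add: "facet k (x + y) = facet k x + facet k y"
  by (auto simp: facet_def add_divide_distrib sum.distrib distrib_right split: option.split)

lemma facet_scale: "facet k (c *\<^sub>R y) = c * facet k y"
  by (auto simp: facet_def sum_distrib_left right_diff_distrib split: option.split)

lemma real_vec_add: "real_vec (u + v) = real_vec u + real_vec v"
  by (simp add: real_vec_def vec_eq_iff)

lemma L_vertex: "L k (vertex j) = 1 - (if j = k then \<delta> k else 0)"
proof (cases j)
  case None
  have "(\<Sum>j\<in>UNIV. real_vec (expG d) $ j / real (a j)) = 1 - \<kappa>"
    by (simp add: real_vec_def expG_def \<kappa>_def sum_negf)
  thus ?thesis using None
    by (cases k) (auto simp: L_def facet_def vertex_def \<delta>_def real_vec_def expG_def)
next
  case (Some i)
  have "(\<Sum>j\<in>UNIV. real_vec (expA a i) $ j / real (a j)) = (\<Sum>j\<in>UNIV. if j = i then 1 else 0)"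
    using a_pos by (intro sum.cong) (auto simp: real_vec_def expA_def)
  also have "\<dots> = 1" by simp
  finally show ?thesis using Some
    by (cases k) (auto simp: L_def facet_def vertex_def \<delta>_def real_vec_def expA_def)
qed

lemma L_add_vertex: "L k (v + vertex j) = L k v + 1 - (if j = k then \<delta> k else 0)"
  using L_vertex[of k j] by (simp add: L_def real_vec_add facet_add)

lemma L_diff_vertex: "L k (v - vertex j) = L k v - 1 + (if j = k then \<delta> k else 0)"
  using L_add_vertex[of k "v - vertex j" j] by simp

lemma rank_less: "i < j \<Longrightarrow> rank (Some i) < rank (Some j)"
  unfolding rank_def option.case by (rule psubset_card_mono) auto

lemma rank_Some_less: "rank (Some i) < rank None"
  unfolding rank_def option.case by (rule psubset_card_mono) auto

lemma rank_le: "rank k \<le> CARD('n)"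
  by (auto simp: rank_def card_mono split: option.split)

lemma rank_inj: "rank j = rank k \<Longrightarrow> j = k"
proof (cases j; cases k)
  fix x y assume "rank j = rank k" "j = Some x" "k = Some y"
  thus "j = k" using rank_less[of x y] rank_less[of y x] by (cases x y rule: linorder_cases) auto
qed (use rank_Some_less in \<open>auto simp: less_le\<close>)

lemma beats_antisym: "beats v j k \<Longrightarrow> \<not> beats v k j"
  by (auto simp: beats_def)

lemma arg_beats: "j \<noteq> arg v \<Longrightarrow> beats v (arg v) j"
proof -
  have "Max (range (\<lambda>j. L j v)) \<in> range (\<lambda>j. L j v)" by (rule Max_in) auto
  then obtain m where "L m v = Max (range (\<lambda>j. L j v))" by (metis rangeE)
  hence m: "L j v \<le> L m v" for j by simp
  obtain k where k: "L k v = L m v" "\<And>j. L j v = L m v \<Longrightarrow> rank k \<le> rank j"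
    using ex_has_least_nat[of "\<lambda>k. L k v = L m v" m rank] by blast
  have "\<forall>j. j \<noteq> k \<longrightarrow> beats v k j"
    using m k rank_inj unfolding beats_def by (metis order_less_le)
  hence "\<forall>j. j \<noteq> arg v \<longrightarrow> beats v (arg v) j"
    unfolding arg_def by (rule someI)
  thus "j \<noteq> arg v \<Longrightarrow> beats v (arg v) j" by blast
qed

lemma arg_eqI: "(\<And>j. j \<noteq> k \<Longrightarrow> beats v k j) \<Longrightarrow> arg v = k"
  using arg_beats[of k v] beats_antisym by blast

lemma arg_eq_iff: "arg v = k \<longleftrightarrow> (\<forall>j. j \<noteq> k \<longrightarrow> beats v k j)"
  using arg_beats arg_eqI by blast

lemma L_le_arg: "L j v \<le> L (arg v) v"
  using arg_beats[of j v] by (cases "j = arg v") (auto simp: beats_def)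

text \<open>Adding the vertex j raises every facet form by 1 except that of j, which gains less; a
  winner other than j therefore keeps winning.\<close>

lemma arg_add_vertex:
  assumes "j \<noteq> arg v"
  shows "arg (v + vertex j) = arg v"
proof (rule arg_eqI)
  fix k assume "k \<noteq> arg v"
  from arg_beats[OF this] show "beats (v + vertex j) (arg v) k"
    using assms \<delta>_pos[of k] by (auto simp: beats_def L_add_vertex)
qed

lemma arg_diff_vertex:
  "(\<forall>j. arg (v - vertex j) = j) \<longleftrightarrow>
     (\<forall>i j. i \<noteq> j \<longrightarrow> L i v < L j v + \<delta> j \<or> L i v = L j v + \<delta> j \<and> rank j < rank i)"
  unfolding arg_eq_iff beats_def L_diff_vertex by (auto simp: algebra_simps)

text \<open>By \<open>arg_diff_vertex\<close> there is one comparison for each ordered pair (i, j)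
  of facets, weak exactly if j has smaller rank than i. The pair (None, Some j) gives v_j \<le> a_j,
  the pair (Some i, None) gives -d_i < v_i, and two coordinates give the mixed inequalities. The
  common factor \<kappa> cancels throughout.\<close>

lemma setB_eq: "setB a d = {v. \<forall>j. arg (v - vertex j) = j}"
proof -
  have 1: "L None v < L (Some j) v + \<delta> (Some j) \<or> L None v = L (Some j) v + \<delta> (Some j) \<longleftrightarrow>
      v $ j \<le> int (a j)" for v j
  proof -
    have "L None v < L (Some j) v + \<delta> (Some j) \<or> L None v = L (Some j) v + \<delta> (Some j) \<longleftrightarrow>
        L None v \<le> L (Some j) v + \<delta> (Some j)" by linarith
    also have "\<dots> \<longleftrightarrow> real_of_int (v $ j) / real (d j) * \<kappa> \<le> real (a j) / real (d j) * \<kappa>"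
      by (simp add: L_def facet_def \<delta>_def real_vec_def)
    also have "\<dots> \<longleftrightarrow> real_of_int (v $ j) \<le> real (a j)"
      using \<kappa>_pos d_pos[of j] by (simp add: divide_le_cancel)
    finally show ?thesis by (metis of_int_le_iff of_int_of_nat_eq)
  qed
  have 2: "L (Some i) v < L None v + \<delta> None \<longleftrightarrow> - int (d i) < v $ i" for v i
  proof -
    have "L (Some i) v < L None v + \<delta> None \<longleftrightarrow> (-1) * \<kappa> < real_of_int (v $ i) / real (d i) * \<kappa>"
      by (simp add: L_def facet_def \<delta>_def real_vec_def) linarith
    also have "\<dots> \<longleftrightarrow> -1 < real_of_int (v $ i) / real (d i)"
      by (rule mult_less_cancel_right_pos[OF \<kappa>_pos])
    also have "\<dots> \<longleftrightarrow> - real (d i) < real_of_int (v $ i)"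
      using d_pos[of i] by (simp add: pos_less_divide_eq)
    finally show ?thesis by (metis of_int_less_iff of_int_minus of_int_of_nat_eq)
  qed
  have 3: "L (Some i) v < L (Some j) v + \<delta> (Some j) \<longleftrightarrow>
      real_of_int (v $ j) < real (d j) / real (d i) * real_of_int (v $ i) + real (a j)" for v i j
  proof -
    have "L (Some i) v < L (Some j) v + \<delta> (Some j) \<longleftrightarrow>
      real_of_int (v $ j) / real (d j) * \<kappa> < (real_of_int (v $ i) / real (d i) + real (a j) / real (d j)) * \<kappa>"
      by (simp add: L_def facet_def \<delta>_def real_vec_def distrib_right) linarith
    also have "\<dots> \<longleftrightarrow> real_of_int (v $ j) / real (d j) < real_of_int (v $ i) / real (d i) + real (a j) / real (d j)"
      by (rule mult_less_cancel_right_pos[OF \<kappa>_pos])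
    also have "\<dots> \<longleftrightarrow> real_of_int (v $ j) < (real_of_int (v $ i) / real (d i) + real (a j) / real (d j)) * real (d j)"
      using d_pos[of j] by (intro pos_divide_less_eq) simp
    also have "(real_of_int (v $ i) / real (d i) + real (a j) / real (d j)) * real (d j) =
        real (d j) / real (d i) * real_of_int (v $ i) + real (a j)"
      using d_pos[of j] by (simp add: distrib_right)
    finally show ?thesis .
  qed
  have 4: "L (Some i) v < L (Some j) v + \<delta> (Some j) \<or> L (Some i) v = L (Some j) v + \<delta> (Some j) \<longleftrightarrow>
      real (d i) / real (d j) * (real_of_int (v $ j) - real (a j)) \<le> real_of_int (v $ i)" for v i j
  proof -
    have "L (Some i) v < L (Some j) v + \<delta> (Some j) \<or> L (Some i) v = L (Some j) v + \<delta> (Some j) \<longleftrightarrow>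
      (real_of_int (v $ j) - real (a j)) / real (d j) * \<kappa> \<le> real_of_int (v $ i) / real (d i) * \<kappa>"
      by (simp add: L_def facet_def \<delta>_def real_vec_def diff_divide_distrib left_diff_distrib) linarith
    also have "\<dots> \<longleftrightarrow> (real_of_int (v $ j) - real (a j)) / real (d j) \<le> real_of_int (v $ i) / real (d i)"
      by (rule mult_le_cancel_right_pos[OF \<kappa>_pos])
    also have "\<dots> \<longleftrightarrow> (real_of_int (v $ j) - real (a j)) / real (d j) * real (d i) \<le> real_of_int (v $ i)"
      using d_pos[of i] by (intro pos_le_divide_eq) simp
    finally show ?thesis by (simp add: mult.commute)
  qed
  have opt: "(\<forall>i. P i) \<longleftrightarrow> P None \<and> (\<forall>i. P (Some i))" for P :: "'n option \<Rightarrow> bool"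
    by (metis option.exhaust)
  have rank_iff: "rank (Some j) < rank (Some i) \<longleftrightarrow> j < i" for i j
    using rank_less[of i j] rank_less[of j i] by (cases i j rule: linorder_cases) auto
  have "(\<forall>i j. i \<noteq> j \<longrightarrow> L i v < L j v + \<delta> j \<or> L i v = L j v + \<delta> j \<and> rank j < rank i) \<longleftrightarrow>
     (\<forall>i. - int (d i) < v $ i \<and> v $ i \<le> int (a i)) \<and>
         (\<forall>i j. i < j \<longrightarrow>
            real (d j) / real (d i) * (of_int (v $ i) - real (a i)) \<le> of_int (v $ j) \<and>
            of_int (v $ j) < real (d j) / real (d i) * of_int (v $ i) + real (a j))" (is "?l \<longleftrightarrow> ?r") for v
  proof -
    have "?l \<longleftrightarrow> (\<forall>j. L None v < L (Some j) v + \<delta> (Some j) \<or> L None v = L (Some j) v + \<delta> (Some j)) \<and>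
        (\<forall>i. L (Some i) v < L None v + \<delta> None) \<and>
        (\<forall>i j. i \<noteq> j \<longrightarrow> L (Some i) v < L (Some j) v + \<delta> (Some j) \<or>
           L (Some i) v = L (Some j) v + \<delta> (Some j) \<and> j < i)"
      unfolding opt using rank_Some_less rank_iff by (auto simp: less_le_not_le)
    also have "(\<forall>i j. i \<noteq> j \<longrightarrow> L (Some i) v < L (Some j) v + \<delta> (Some j) \<or>
           L (Some i) v = L (Some j) v + \<delta> (Some j) \<and> j < i) \<longleftrightarrow>
        (\<forall>i j. i < j \<longrightarrow> (L (Some j) v < L (Some i) v + \<delta> (Some i) \<or> L (Some j) v = L (Some i) v + \<delta> (Some i))
          \<and> L (Some i) v < L (Some j) v + \<delta> (Some j))"
      by (metis neqE less_asym less_irrefl)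
    finally show ?thesis unfolding 1 4 unfolding 2 3 by blast
  qed
  thus ?thesis unfolding setB_def arg_diff_vertex by auto
qed

lemma finite_setB: "finite (setB a d)"
proof -
  have "setB a d \<subseteq> vec_lambda ` (PiE UNIV (\<lambda>i. {- int (d i)..int (a i)}))"
  proof
    fix v assume "v \<in> setB a d"
    hence "($) v \<in> PiE UNIV (\<lambda>i. {- int (d i)..int (a i)})" by (auto simp: setB_def PiE_def less_imp_le)
    thus "v \<in> vec_lambda ` (PiE UNIV (\<lambda>i. {- int (d i)..int (a i)}))"
      by (intro image_eqI[of _ _ "($) v"]) auto
  qed
  thus ?thesis by (rule finite_subset) (intro finite_imageI finite_PiE; simp)
qed

section \<open>The weight as the maximum of the facet forms\<close>

text \<open>If v is the sum of t_j V_j and T is the sum of the t_j, then \<open>L_vertex\<close>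
  gives L k v = T - t_k \<delta> k. The n+1 vertices are dependent, so T is free; T = L (arg v) v
  makes the coefficient of \<open>arg v\<close> zero and all others nonnegative.\<close>

lemma real_vec_decomp:
  "real_vec v = (\<Sum>j\<in>UNIV. ((L (arg v) v - L j v) / \<delta> j) *\<^sub>R real_vec (vertex j))" (is ?A)
  "(\<Sum>j\<in>UNIV. (L (arg v) v - L j v) / \<delta> j) = L (arg v) v" (is ?B)
proof -
  \<comment> \<open>M is the coefficient of \<open>expG d\<close>; the others are then forced by the
    coordinates v_i = t_i a_i - M d_i.\<close>
  define M where "M = (L (arg v) v - L None v) / \<kappa>"
  have None: "(L (arg v) v - L None v) / \<delta> None = M" by (simp add: M_def \<delta>_def)
  have Some: "(L (arg v) v - L (Some i) v) / \<delta> (Some i) = (of_int (v $ i) + M * real (d i)) / real (a i)" for i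
  proof -
    have "L (arg v) v - L None v = M * \<kappa>" using \<kappa>_pos by (simp add: M_def)
    moreover have "L None v - L (Some i) v = of_int (v $ i) / real (d i) * \<kappa>"
      by (simp add: L_def facet_def real_vec_def)
    ultimately have "L (arg v) v - L (Some i) v = (M + of_int (v $ i) / real (d i)) * \<kappa>"
      unfolding distrib_right by linarith
    thus ?thesis using \<kappa>_pos a_pos[of i] d_pos[of i] by (simp add: \<delta>_def field_simps)
  qed
  show ?A
  proof (rule vec_eq_iff[THEN iffD2, rule_format])
    fix k
    have "(\<Sum>j\<in>UNIV. ((L (arg v) v - L j v) / \<delta> j) *\<^sub>R real_vec (vertex j)) $ k =
        M * (- real (d k)) + (\<Sum>i\<in>UNIV. (of_int (v $ i) + M * real (d i)) / real (a i) * (if k = i then real (a i) else 0))"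
      unfolding sum_option None Some
      by (simp add: vertex_def real_vec_def expG_def expA_def if_distrib[of real_of_int] cong: if_cong)
    also have "\<dots> = real_of_int (v $ k)"
      using a_pos[of k] by (simp add: if_distrib[of "\<lambda>x. _ * x"] cong: if_cong)
    finally show "real_vec v $ k = (\<Sum>j\<in>UNIV. ((L (arg v) v - L j v) / \<delta> j) *\<^sub>R real_vec (vertex j)) $ k"
      by (simp add: real_vec_def)
  qed
  have "(\<Sum>j\<in>UNIV. (L (arg v) v - L j v) / \<delta> j) =
      M + (\<Sum>i\<in>UNIV. (of_int (v $ i) + M * real (d i)) / real (a i))"
    unfolding sum_option None Some ..
  also have "\<dots> = L None v + M * \<kappa>"
    by (simp add: \<kappa>_def L_def facet_def real_vec_def add_divide_distrib sum.distrib
        sum_distrib_left distrib_left)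
  finally show ?B using \<kappa>_pos by (simp add: M_def)
qed

lemma decomp_nonneg: "0 \<le> (L (arg v) v - L j v) / \<delta> j"
  using L_le_arg[of j v] \<delta>_pos[of j] by simp

lemma L_arg_nonneg: "0 \<le> L (arg v) v"
proof -
  have "0 \<le> (\<Sum>j\<in>UNIV. (L (arg v) v - L j v) / \<delta> j)"
    by (rule sum_nonneg[OF decomp_nonneg])
  thus ?thesis by (simp only: real_vec_decomp(2))
qed

lemma polytope_eq: "polytope_Delta a d = convex hull (insert 0 (range (real_vec \<circ> vertex)))"
proof -
  have "{0} \<union> range (\<lambda>j. real_vec (expA a j)) \<union> {real_vec (expG d)} = insert 0 (range (real_vec \<circ> vertex))"
    by (simp add: UNIV_option_conv image_image vertex_def insert_commute)
  thus ?thesis by (simp add: polytope_Delta_def)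
qed

lemma facet_polytope: "y \<in> polytope_Delta a d \<Longrightarrow> facet k y \<le> 1"
proof -
  have "convex {y. facet k y \<le> 1}"
  proof (rule convexI)
    fix x y :: "(real, 'n) vec" and u v :: real
    assume xy: "x \<in> {y. facet k y \<le> 1}" "y \<in> {y. facet k y \<le> 1}" and uv: "0 \<le> u" "0 \<le> v" "u + v = 1"
    have "u * facet k x + v * facet k y \<le> u * 1 + v * 1"
      using xy uv by (intro add_mono mult_left_mono) auto
    thus "u *\<^sub>R x + v *\<^sub>R y \<in> {y. facet k y \<le> 1}" using uv by (simp add: facet_add facet_scale)
  qed
  moreover have "insert 0 (range (real_vec \<circ> vertex)) \<subseteq> {y. facet k y \<le> 1}"
    using L_vertex[of k] \<delta>_pos[of k] facet_scale[of k 0 0]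
    by (auto simp flip: L_def)
  ultimately have "polytope_Delta a d \<subseteq> {y. facet k y \<le> 1}"
    unfolding polytope_eq by (intro hull_minimal)
  thus "y \<in> polytope_Delta a d \<Longrightarrow> facet k y \<le> 1" by blast
qed

text \<open>Necessity holds because every facet form is at most 1 on the polytope. Conversely, the
  decomposition puts v into the dilate by w = L (arg v) v, and larger dilates contain it since 0
  belongs to the polytope.\<close>

lemma mem_dilated_polytope:
  assumes "0 \<le> c"
  shows "real_vec v \<in> (\<lambda>y. c *\<^sub>R y) ` polytope_Delta a d \<longleftrightarrow> L (arg v) v \<le> c"
proof
  assume "real_vec v \<in> (\<lambda>y. c *\<^sub>R y) ` polytope_Delta a d"
  then obtain y where y: "real_vec v = c *\<^sub>R y" "y \<in> polytope_Delta a d" by blast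
  have "L (arg v) v = c * facet (arg v) y" by (simp add: L_def y(1) facet_scale)
  also have "\<dots> \<le> c * 1" using facet_polytope[OF y(2)] assms by (intro mult_left_mono)
  finally show "L (arg v) v \<le> c" by simp
next
  assume le: "L (arg v) v \<le> c"
  let ?c = "\<lambda>j. (L (arg v) v - L j v) / \<delta> j" and ?P = "polytope_Delta a d"
  have P: "convex ?P" "0 \<in> ?P" "\<And>j. real_vec (vertex j) \<in> ?P"
    unfolding polytope_eq by (auto intro!: hull_inc)
  show "real_vec v \<in> (\<lambda>y. c *\<^sub>R y) ` ?P"
  proof (cases "L (arg v) v = 0")
    case True
    hence 0: "?c j = 0" for j
      using real_vec_decomp(2)[of v] decomp_nonneg[of v] sum_nonneg_eq_0_iff[of UNIV ?c] by auto
    have "real_vec v = 0"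
      by (subst real_vec_decomp(1)) (simp only: 0 scaleR_zero_left sum.neutral_const)
    thus ?thesis using P(2) by (intro image_eqI[of _ _ 0]) auto
  next
    case False
    define w where "w = L (arg v) v"
    have w: "w > 0" using False L_arg_nonneg[of v] by (simp add: w_def)
    define y where "y = (\<Sum>j\<in>UNIV. (?c j / w) *\<^sub>R real_vec (vertex j))"
    have "y \<in> ?P" unfolding y_def
    proof (rule convex_sum[OF _ P(1)])
      show "(\<Sum>j\<in>UNIV. ?c j / w) = 1"
        unfolding sum_divide_distrib[symmetric] real_vec_decomp(2) using w by (simp add: w_def)
    qed (use w decomp_nonneg P(3) in \<open>auto intro!: divide_nonneg_pos simp del: divide_divide_eq_left\<close>)
    hence "(w / c) *\<^sub>R y + (1 - w / c) *\<^sub>R 0 \<in> ?P"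
      using P(1,2) w le by (intro convexD) (auto simp: w_def)
    moreover have "real_vec v = w *\<^sub>R y"
      using real_vec_decomp(1)[of v] w by (simp add: y_def scaleR_sum_right)
    ultimately show ?thesis using w le by (intro image_eqI[of _ _ "(w / c) *\<^sub>R y"]) (auto simp: w_def)
  qed
qed

lemma estar_pos: "estar a d > 0"
  using a_pos d_pos by (auto simp: estar_def Lcm_0_iff lcm_pos_nat intro!: Nat.gr0I)

text \<open>For n = 1, \<kappa> = 1 + d/a collapses the second facet form to -v/d, so the lcm of a
  and d clears both denominators. Otherwise \<kappa> v_i/d_i has products of d_i with numbers a_j as
  denominators, which the product of the two lcms clears.\<close>

lemma estar_L_int: "\<exists>z::int. real (estar a d) * L k v = of_int z"
proof -
  let ?A = "Lcm (range a)" and ?D = "Lcm (range d)"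
  have div: "\<exists>z::int. real M * (of_int x / real y) = of_int z" if "y dvd M" for M y and x :: int
  proof (cases "y = 0")
    case False
    obtain q where "M = y * q" using \<open>y dvd M\<close> by (elim dvdE) auto
    thus ?thesis using False by (intro exI[of _ "int q * x"]) simp
  qed (auto intro: exI[of _ 0])
  have sum: "\<exists>z::int. (\<Sum>j\<in>A. f j) = of_int z" if f: "\<And>j. \<exists>z::int. f j = of_int z"
    for f :: "'n \<Rightarrow> real" and A
  proof -
    obtain z where "\<And>j. f j = of_int (z j)" using f by metis
    thus ?thesis by (intro exI[of _ "sum z A"]) simp
  qed
  have a: "a j dvd ?A" and d: "d j dvd ?D" for j by auto
  show ?thesis
  proof (cases "CARD('n) = 1")
    case True
    then obtain i where i: "UNIV = {i::'n}" by (auto simp: card_1_singleton_iff)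
    have "k = None \<or> k = Some i" using i by (cases k) auto
    moreover have "L None v = of_int (v $ i) / real (a i)" by (simp add: L_def facet_def i real_vec_def)
    moreover have "L (Some i) v = of_int (- v $ i) / real (d i)"
      using a_pos[of i] d_pos[of i] by (simp add: L_def facet_def i real_vec_def \<kappa>_def field_simps)
    moreover have "a i dvd estar a d" "d i dvd estar a d" using True a[of i] d[of i]
      by (auto simp: estar_def intro: dvd_trans)
    ultimately show ?thesis using div by metis
  next
    case False
    hence E: "estar a d = ?A * ?D" by (simp add: estar_def)
    have 1: "\<exists>z::int. real (estar a d) * (\<Sum>j\<in>UNIV. real_vec v $ j / real (a j)) = of_int z"
      unfolding sum_distrib_left
    proof (rule sum)
      show "\<exists>z::int. real (estar a d) * (real_vec v $ j / real (a j)) = of_int z" for j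
        unfolding real_vec_def using a[of j] by (simp only: vec_lambda_beta) (intro div, simp add: E)
    qed
    show ?thesis
    proof (cases k)
      case None
      thus ?thesis using 1 by (simp add: L_def facet_def)
    next
      case (Some i)
      obtain x :: int where x: "real ?D * (of_int (v $ i) / real (d i)) = of_int x" using div[OF d] by blast
      have "\<exists>z::int. (\<Sum>j\<in>UNIV. real ?A * (of_int (int (d j)) / real (a j))) = of_int z"
        by (rule sum) (rule div[OF a])
      then obtain y :: int where y: "real ?A * (\<Sum>j\<in>UNIV. real (d j) / real (a j)) = of_int y"
        by (auto simp: sum_distrib_left)
      have "real (estar a d) * (of_int (v $ i) / real (d i) * \<kappa>) =
          (real ?D * (of_int (v $ i) / real (d i))) * (real ?A + real ?A * (\<Sum>j\<in>UNIV. real (d j) / real (a j)))"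
        by (simp add: E \<kappa>_def algebra_simps)
      also have "\<dots> = of_int (x * (int ?A + y))" unfolding x y by simp
      finally obtain z :: int where "real (estar a d) * (of_int (v $ i) / real (d i) * \<kappa>) = of_int z" by blast
      moreover obtain z' :: int where "real (estar a d) * (\<Sum>j\<in>UNIV. real_vec v $ j / real (a j)) = of_int z'"
        using 1 by blast
      ultimately show ?thesis using Some
        by (intro exI[of _ "z' - z"]) (simp add: L_def facet_def right_diff_distrib real_vec_def)
    qed
  qed
qed

text \<open>Integrality of the multiple by \<open>estar a d\<close> shows that L (arg v) v is
  rational, so the least element over the rationals in \<open>weight\<close> is attained at the real
  minimum.\<close>

lemma eweight_eq: "real (eweight a d v) = real (estar a d) * L (arg v) v"
proof -
  obtain z :: int where z: "real (estar a d) * L (arg v) v = of_int z" using estar_L_int by blast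
  define c :: rat where "c = of_int z / of_nat (estar a d)"
  have c: "L (arg v) v = real_of_rat c"
    using z estar_pos by (simp add: c_def of_rat_divide field_simps)
  have "weight a d v = c" unfolding weight_def
  proof (rule Least_equality)
    show "0 \<le> c \<and> real_vec v \<in> (\<lambda>y. real_of_rat c *\<^sub>R y) ` polytope_Delta a d"
      using L_arg_nonneg[of v] mem_dilated_polytope[of "real_of_rat c" v] by (simp add: c)
    show "c \<le> y" if "0 \<le> y \<and> real_vec v \<in> (\<lambda>x. real_of_rat y *\<^sub>R x) ` polytope_Delta a d" for y
      using that mem_dilated_polytope[of "real_of_rat y" v] by (simp add: c of_rat_less_eq)
  qed
  hence "of_nat (estar a d) * weight a d v = of_int z"
    using estar_pos by (simp add: c_def)
  moreover have "z \<ge> 0" using z L_arg_nonneg[of v] by (metis of_int_0_le_iff of_nat_0_le_iff zero_le_mult_iff)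
  ultimately show ?thesis unfolding eweight_def z by simp
qed

text \<open>The lexicographic pair of weight and reversed rank, coded as one number: the second
  entry is at most \<open>CARD('n)\<close>, so the base \<open>Suc CARD('n)\<close> avoids
  overlap.\<close>

definition fine_weight :: "(int, 'n) vec \<Rightarrow> nat" where
  "fine_weight v = Suc CARD('n) * eweight a d v + (CARD('n) - rank (arg v))"

lemma eweight_add_vertex: "eweight a d (v + vertex j) \<le> eweight a d v + estar a d"
proof -
  have "L (arg (v + vertex j)) (v + vertex j) \<le> L (arg v) v + 1"
    using L_le_arg[of "arg (v + vertex j)" v] \<delta>_pos[of j] by (auto simp: L_add_vertex)
  hence "real (estar a d) * L (arg (v + vertex j)) (v + vertex j) \<le> real (estar a d) * (L (arg v) v + 1)"
    by (intro mult_left_mono) auto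
  hence "real (eweight a d (v + vertex j)) \<le> real (eweight a d v + estar a d)"
    by (simp add: eweight_eq distrib_left)
  thus ?thesis by (simp only: of_nat_le_iff)
qed

lemma eweight_add_other_vertex:
  assumes "j \<noteq> arg v"
  shows "eweight a d (v + vertex j) = eweight a d v + estar a d"
proof -
  have "real (eweight a d (v + vertex j)) = real (eweight a d v + estar a d)"
    using assms by (simp add: eweight_eq arg_add_vertex L_add_vertex distrib_left)
  thus ?thesis by (simp only: of_nat_eq_iff)
qed

lemma fine_weight_add_other_vertex:
  "j \<noteq> arg v \<Longrightarrow> fine_weight (v + vertex j) = fine_weight v + Suc CARD('n) * estar a d"
  by (simp add: fine_weight_def eweight_add_other_vertex arg_add_vertex algebra_simps)

text \<open>Either the weight grows by less than \<open>estar a d\<close>, which outweighs any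
  change of rank, or a facet tied with \<open>arg v\<close> takes over. Having lost the tie at v,
  that facet has larger rank.\<close>

lemma fine_weight_add_arg_vertex:
  "fine_weight (v + vertex (arg v)) < fine_weight v + Suc CARD('n) * estar a d"
proof -
  define i where "i = arg v"
  define k where "k = arg (v + vertex i)"
  show ?thesis
  proof (cases "eweight a d (v + vertex i) = eweight a d v + estar a d")
    case True
    hence "real (estar a d) * L k (v + vertex i) = real (estar a d) * (L i v + 1)"
      using eweight_eq[of v] eweight_eq[of "v + vertex i"] by (simp add: i_def k_def distrib_left)
    hence eq: "L k (v + vertex i) = L i v + 1" using estar_pos by simp
    hence ne: "k \<noteq> i" using \<delta>_pos[of i] by (auto simp: L_add_vertex)
    hence "L k v = L i v" using eq by (simp add: L_add_vertex)
    hence "rank i < rank k" using arg_beats[of k v] ne by (auto simp: beats_def i_def)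
    hence "CARD('n) - rank k < CARD('n) - rank i" using rank_le[of k] by linarith
    thus ?thesis unfolding fine_weight_def i_def[symmetric] k_def[symmetric] True
      by (simp only: distrib_left)
  next
    case False
    hence "Suc (eweight a d (v + vertex i)) \<le> eweight a d v + estar a d"
      using eweight_add_vertex[of v i] by simp
    hence "Suc CARD('n) * Suc (eweight a d (v + vertex i)) \<le> Suc CARD('n) * (eweight a d v + estar a d)"
      by (rule mult_le_mono2)
    thus ?thesis unfolding fine_weight_def i_def[symmetric] by (simp add: algebra_simps)
  qed
qed

end

section \<open>The quotient of the space of series\<close>

lemma sum_fun_apply: "(\<Sum>i\<in>A. f i) x = (\<Sum>i\<in>A. f i x)"
  by (induction A rule: infinite_finite_induct) auto

locale dwork_series = exponents a d + nonarch abv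
  for a d :: "'n::{finite, linorder} \<Rightarrow> nat" and abv :: "'k::field_char_0 \<Rightarrow> real" +
  fixes K :: "'k set" and t lam :: 'k
  assumes subfield: "is_subfield K" and complete: "complete_under abv K"
    and t_K: "t \<in> K" and t_le: "abv t \<le> 1" and t_0: "t \<noteq> 0"
    and lam_K: "lam \<in> K" and lam_unit: "abv lam = 1"
    and a_unit: "abv (of_nat (a i)) = 1" and d_unit: "abv (of_nat (d i)) = 1"
begin

definition term_coeff :: "'n option \<Rightarrow> 'k" where
  "term_coeff j = (case j of None \<Rightarrow> lam | Some i \<Rightarrow> 1)"

text \<open>
  For \<open>i \<noteq> k\<close>, the linear form with coefficients \<open>pair_form i k\<close> vanishes on all vertices
  except \<open>i\<close> and \<open>k\<close>.
\<close>

definition pair_form :: "'n option \<Rightarrow> 'n option \<Rightarrow> 'n \<Rightarrow> 'k" where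
  "pair_form i k l = (case i of
     None \<Rightarrow> (if k = Some l then 1 else 0)
   | Some m \<Rightarrow> (case k of
        None \<Rightarrow> (if l = m then 1 else 0)
      | Some k' \<Rightarrow> (if l = k' then of_nat (d m) else 0) - (if l = m then of_nat (d k') else 0)))"

text \<open>For i = None the forms are the coordinates themselves. For i = Some m it encodes u_l =
  (d_l/d_m) u_m + (1/d_m)(d_m u_l - d_l u_m).\<close>

definition pair_form_inverse :: "'n option \<Rightarrow> 'n \<Rightarrow> 'n option \<Rightarrow> 'k" where
  "pair_form_inverse i l k = (case i of
     None \<Rightarrow> (if k = Some l then 1 else 0)
   | Some m \<Rightarrow> (case k of
        None \<Rightarrow> of_nat (d l) / of_nat (d m)
      | Some k' \<Rightarrow> (if k' = l then 1 / of_nat (d m) else 0)))"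

lemma sum_pair_form:
  "(\<Sum>l\<in>UNIV. pair_form i k l * f l) = (case i of
     None \<Rightarrow> (case k of None \<Rightarrow> 0 | Some k' \<Rightarrow> f k')
   | Some m \<Rightarrow> (case k of None \<Rightarrow> f m | Some k' \<Rightarrow> of_nat (d m) * f k' - of_nat (d k') * f m))"
proof -
  have [simp]: "(\<Sum>l\<in>UNIV. (if l = m then x else 0) * f l) = x * f m" for m x
    by (simp add: if_distrib[of "\<lambda>y. y * _"] cong: if_cong)
  have [simp]: "(\<Sum>l\<in>UNIV. (if m = l then x else 0) * f l) = x * f m" for m x
    by (simp add: if_distrib[of "\<lambda>y. y * _"] cong: if_cong)
  show ?thesis
    by (cases i; cases k) (simp_all add: pair_form_def left_diff_distrib sum_subtractf)
qed

lemma vertex_nth: "vertex j $ l = (case j of None \<Rightarrow> - int (d l) | Some i \<Rightarrow> if l = i then int (a i) else 0)"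
  by (auto simp: vertex_def expG_def expA_def split: option.split)

lemma vertex_inj: "inj vertex"
proof (rule injI, rule ccontr)
  fix j k assume eq: "vertex j = vertex k" and "j \<noteq> k"
  thus False using L_vertex[of k j] L_vertex[of k k] \<delta>_pos[of k] by simp
qed

lemma of_int_integers: "of_int z \<in> integers_of abv K"
  by (simp add: integers_of_def abv_of_int_le is_subfieldD(10)[OF subfield])

sublocale facet_reduction abv K t "\<lambda>l u. of_int (u $ l)" vertex term_coeff
  "eweight a d" fine_weight "estar a d" "Suc CARD('n) * estar a d" arg pair_form pair_form_inverse
proof
  show "is_subfield K" "complete_under abv K" "t \<in> K" "abv t \<le> 1"
    by (rule subfield complete t_K t_le)+
  show "term_coeff j \<in> K" "abv (term_coeff j) = 1" for j
    using lam_K lam_unit is_subfieldD(2)[OF subfield] by (auto simp: term_coeff_def split: option.split)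
  show "pair_form i k l \<in> integers_of abv K" for i k l
  proof -
    have "pair_form i k l = of_int (case i of
       None \<Rightarrow> (if k = Some l then 1 else 0)
     | Some m \<Rightarrow> (case k of
          None \<Rightarrow> (if l = m then 1 else 0)
        | Some k' \<Rightarrow> (if l = k' then int (d m) else 0) - (if l = m then int (d k') else 0)))"
      by (auto simp: pair_form_def split: option.split)
    thus ?thesis using of_int_integers by simp
  qed
  show "(\<Sum>l\<in>UNIV. pair_form i k l * of_int (vertex m $ l)) = 0"
    if "i \<noteq> k" "m \<noteq> i" "m \<noteq> k" for i k m
    using that unfolding sum_pair_form by (cases i; cases k; cases m) (auto simp: vertex_nth)
  show "abv (\<Sum>l\<in>UNIV. pair_form i k l * of_int (vertex k $ l)) = 1" if "i \<noteq> k" for i k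
    using that a_unit d_unit unfolding sum_pair_form
    by (auto simp: vertex_nth abv_mult split: option.split)
  show "of_int (u $ l) = (\<Sum>k\<in>-{i}. pair_form_inverse i l k * (\<Sum>m\<in>UNIV. pair_form i k m * of_int (u $ m)))"
    for l i and u :: "(int, 'n) vec"
  proof (cases i)
    case None
    have "- {None} = range (Some :: 'n \<Rightarrow> _)" by (auto simp: image_iff)
    thus ?thesis unfolding sum_pair_form using None
      by (simp add: sum.reindex pair_form_inverse_def if_distrib[of "\<lambda>y. y * _"] cong: if_cong)
  next
    case (Some m)
    let ?f = "\<lambda>k. pair_form_inverse i l k * (\<Sum>m\<in>UNIV. pair_form i k m * of_int (u $ m))"
    have 0: "of_nat (d m) \<noteq> (0 :: 'k)" by simp
    have "?f (Some m) = 0" unfolding sum_pair_form by (simp add: Some)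
    hence "(\<Sum>k\<in>-{i}. ?f k) = (\<Sum>k\<in>UNIV. ?f k)"
      using Some by (intro sum.mono_neutral_left) auto
    also have "\<dots> = of_nat (d l) / of_nat (d m) * of_int (u $ m) +
        1 / of_nat (d m) * (of_nat (d m) * of_int (u $ l) - of_nat (d l) * of_int (u $ m))"
      unfolding sum_option sum_pair_form
      by (simp add: Some pair_form_inverse_def if_distrib[of "\<lambda>y. y * _"] cong: if_cong)
    also have "\<dots> = of_int (u $ l)" using 0 by (simp add: field_simps)
    finally show ?thesis by simp
  qed
  show "finite {v. \<forall>j. arg (v - vertex j) = j}"
    using finite_setB unfolding setB_eq .
qed (use of_int_integers arg_add_vertex eweight_add_vertex eweight_add_other_vertex estar_pos
      fine_weight_add_arg_vertex fine_weight_add_other_vertex in auto)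

lemma basis_eq: "basis = setB a d"
  by (simp add: basis_def setB_eq)

abbreviation \<Theta> :: "'n \<Rightarrow> ((int, 'n) vec \<Rightarrow> 'k) \<Rightarrow> (int, 'n) vec \<Rightarrow> 'k" where
  "\<Theta> \<equiv> opD a d (t ^ estar a d) lam"

definition weighted :: "((int, 'n) vec \<Rightarrow> 'k) \<Rightarrow> (int, 'n) vec \<Rightarrow> 'k" where
  "weighted c = (\<lambda>u. c u * t ^ eweight a d u)"

lemma laurent_F_eq: "laurent_F a d lam v = (\<Sum>j\<in>UNIV. if v = vertex j then term_coeff j else 0)"
  unfolding laurent_F_def sum_option
  by (simp add: sum_fun_apply xmonom_def vertex_def term_coeff_def add.commute cong: if_cong)

lemma series_mult_laurent_F:
  "series_mult (euler_op l (laurent_F a d lam)) f u =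
     (\<Sum>j\<in>UNIV. of_int (vertex j $ l) * term_coeff j * f (u - vertex j))"
proof -
  let ?g = "euler_op l (laurent_F a d lam)"
  have vert: "laurent_F a d lam (vertex j) = term_coeff j" for j
  proof -
    have "laurent_F a d lam (vertex j) = (\<Sum>k\<in>UNIV. if j = k then term_coeff k else 0)"
      unfolding laurent_F_eq using vertex_inj by (intro sum.cong) (auto simp: inj_eq)
    thus ?thesis by simp
  qed
  have sub: "v \<in> range vertex" if "?g v \<noteq> 0" for v
  proof (rule ccontr)
    assume "v \<notin> range vertex"
    hence "laurent_F a d lam v = 0" unfolding laurent_F_eq by (intro sum.neutral) auto
    thus False using that by (simp add: euler_op_def)
  qed
  have "series_mult ?g f u = (\<Sum>v\<in>range vertex. ?g v * f (u - v))"
    unfolding series_mult_def using sub by (intro sum.mono_neutral_left) auto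
  also have "\<dots> = (\<Sum>j\<in>UNIV. ?g (vertex j) * f (u - vertex j))"
    by (subst sum.reindex[OF vertex_inj]) simp
  finally show ?thesis by (simp add: euler_op_def vert)
qed

text \<open>Here \<open>t ^ estar a d\<close> plays the part of \<pi>; the identity
  \<open>ts\<close> trades it for the factor \<open>s\<close> when a vertex is added to the
  exponent.\<close>

lemma opD_weighted: "\<Theta> l (weighted c) = weighted (D (\<lambda>u. of_int (u $ l)) c)"
proof
  fix u
  have ts: "t ^ estar a d * t ^ eweight a d (u - vertex j) = s j (u - vertex j) * t ^ eweight a d u" for j
    using eweight_add_vertex[of "u - vertex j" j] unfolding s_def by (simp flip: power_add add: add_ac)
  have eq: "t ^ estar a d * (x * (y * t ^ eweight a d (u - vertex j))) =
      x * s j (u - vertex j) * y * t ^ eweight a d u" for j x y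
  proof -
    have "t ^ estar a d * (x * (y * t ^ eweight a d (u - vertex j))) =
        x * y * (t ^ estar a d * t ^ eweight a d (u - vertex j))" by (simp only: mult_ac)
    thus ?thesis unfolding ts by (simp only: mult_ac)
  qed
  show "\<Theta> l (weighted c) u = weighted (D (\<lambda>u. of_int (u $ l)) c) u"
    unfolding opD_def series_scale_def plus_fun_apply series_mult_laurent_F
    by (simp add: weighted_def D_def euler_op_def sum_distrib_left sum_distrib_right distrib_right eq)
qed

lemma opD_zero: "\<Theta> l 0 = 0"
  by (rule ext) (simp add: opD_def series_scale_def series_mult_def euler_op_def)

lemma opD_minus: "\<Theta> l (- f) = - \<Theta> l f"
  by (rule ext) (simp add: opD_def series_scale_def series_mult_def euler_op_def sum_negf)

lemma null_iff: "((\<lambda>u. abv (c u)) \<longlongrightarrow> 0) cofinite \<longleftrightarrow> null c"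
  unfolding tendsto_iff null_def eventually_cofinite by (simp add: not_less)

lemma C0_eq: "C0 a d abv R t = {weighted c | c. (\<forall>u. c u \<in> R) \<and> null c}"
  unfolding C0_def null_iff weighted_def ..

lemma C0_minus: "f \<in> C0 a d abv R t \<Longrightarrow> - f \<in> C0 a d abv R t"
proof -
  assume "f \<in> C0 a d abv R t"
  then obtain c where "f = weighted c" "\<forall>u. c u \<in> R" "null c" by (auto simp: C0_eq)
  thus ?thesis unfolding C0_eq
    by (intro CollectI exI[of _ "\<lambda>u. - c u"]) (auto simp: weighted_def null_def fun_eq_iff R_minus)
qed

lemma basis_C0:
  "basis_modulo R series_scale (C0 a d abv R t) (sum_of_images \<Theta> (C0 a d abv R t)) (hatB a d t)"
proof -
  define e :: "(int, 'n) vec \<Rightarrow> (int, 'n) vec \<Rightarrow> 'k" where "e v = xmonom v (t ^ eweight a d v)" for v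
  have e: "e v u = (if u = v then t ^ eweight a d v else 0)" for u v
    by (simp add: e_def xmonom_def)
  have inj: "inj e"
    using t_0 by (intro injI) (metis e power_not_zero)
  have hatB: "hatB a d t = e ` basis"
    by (simp add: hatB_def e_def[abs_def] basis_eq)
  have fin: "finite basis" using finite_basis by (simp add: basis_def)
  have sum_e: "(\<Sum>x\<in>e ` A. series_scale (\<gamma> x) x) = weighted (\<lambda>v. if v \<in> A then \<gamma> (e v) else 0)"
    if "A \<subseteq> basis" for A \<gamma>
  proof
    fix u
    have "finite A" using that fin finite_subset by blast
    thus "(\<Sum>x\<in>e ` A. series_scale (\<gamma> x) x) u = weighted (\<lambda>v. if v \<in> A then \<gamma> (e v) else 0) u"
      by (subst sum.reindex[OF inj_on_subset[OF inj]])
        (auto simp: sum_fun_apply series_scale_def e weighted_def if_distrib[of "\<lambda>y. _ * y"] cong: if_cong)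
  qed
  have images: "sum_of_images \<Theta> (C0 a d abv R t) =
      {weighted (\<lambda>w. \<Sum>l\<in>UNIV. D (\<lambda>u. of_int (u $ l)) (g l) w) | g. \<forall>l. (\<forall>u. g l u \<in> R) \<and> null (g l)}"
    (is "?L = ?R")
  proof -
    have sum: "(\<Sum>l\<in>UNIV. \<Theta> l (weighted (g l))) = weighted (\<lambda>w. \<Sum>l\<in>UNIV. D (\<lambda>u. of_int (u $ l)) (g l) w)" for g
      unfolding opD_weighted by (rule ext) (simp add: sum_fun_apply weighted_def sum_distrib_right)
    show ?thesis
    proof (intro equalityI subsetI)
      fix x assume "x \<in> ?L"
      then obtain f where f: "x = (\<Sum>l\<in>UNIV. \<Theta> l (f l))" "\<forall>l. \<exists>c. f l = weighted c \<and> (\<forall>u. c u \<in> R) \<and> null c"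
        unfolding sum_of_images_def C0_eq by blast
      then obtain g where "\<forall>l. f l = weighted (g l) \<and> (\<forall>u. g l u \<in> R) \<and> null (g l)" by metis
      thus "x \<in> ?R" using f(1) sum by auto
    next
      fix x assume "x \<in> ?R"
      then obtain g where g: "x = weighted (\<lambda>w. \<Sum>l\<in>UNIV. D (\<lambda>u. of_int (u $ l)) (g l) w)"
          "\<forall>l. (\<forall>u. g l u \<in> R) \<and> null (g l)" by blast
      have "weighted (g l) \<in> C0 a d abv R t" for l unfolding C0_eq using g(2) by blast
      thus "x \<in> ?L" unfolding sum_of_images_def g(1) sum[symmetric]
        by (intro CollectI exI[of _ "\<lambda>l. weighted (g l)"]) simp
    qed
  qed
  show ?thesis unfolding basis_modulo_def
  proof (intro conjI ballI allI impI)
    show "hatB a d t \<subseteq> C0 a d abv R t"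
    proof
      fix x assume "x \<in> hatB a d t"
      then obtain v where v: "x = e v" unfolding hatB by blast
      have "x = weighted (\<lambda>u. if u = v then 1 else 0)" by (auto simp: v e weighted_def)
      moreover have "null (\<lambda>u. if u = v then 1 else 0)"
        unfolding null_def by (auto intro: finite_subset[of _ "{v}"])
      ultimately show "x \<in> C0 a d abv R t" unfolding C0_eq using R_0 R_1 by auto
    qed
  next
    fix x assume "x \<in> C0 a d abv R t"
    then obtain c where c: "x = weighted c" "\<And>u. c u \<in> R" "null c" unfolding C0_eq by blast
    obtain \<beta> g where \<beta>: "\<And>w. \<beta> w \<in> R" "\<And>w. w \<notin> basis \<Longrightarrow> \<beta> w = 0"
      and g: "\<And>l w. g l w \<in> R" "\<And>l. null (g l)"
      and eq: "\<And>w. c w = \<beta> w + (\<Sum>l\<in>UNIV. D (\<lambda>u. of_int (u $ l)) (g l) w)"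
      by (rule generation[of c, OF c(2,3)]) blast
    \<comment> \<open>\<open>basis_modulo\<close> indexes coefficients by the basis elements, so the
      exponent has to be recovered from its monomial; e is injective because t is nonzero.\<close>
    have inv: "inv e (e v) = v" for v using inj by simp
    have "(\<Sum>x\<in>e ` basis. series_scale (\<beta> (inv e x)) x) = weighted \<beta>"
      unfolding sum_e[OF subset_refl] using \<beta>(2) by (auto simp: weighted_def inv)
    hence "x - (\<Sum>x\<in>e ` basis. series_scale (\<beta> (inv e x)) x) =
        weighted (\<lambda>w. \<Sum>l\<in>UNIV. D (\<lambda>u. of_int (u $ l)) (g l) w)"
      by (auto simp: c(1) eq weighted_def algebra_simps)
    hence "x - (\<Sum>x\<in>e ` basis. series_scale (\<beta> (inv e x)) x) \<in> sum_of_images \<Theta> (C0 a d abv R t)"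
      unfolding images using g by blast
    thus "\<exists>T \<gamma>. finite T \<and> T \<subseteq> hatB a d t \<and> \<gamma> ` T \<subseteq> R \<and>
        x - (\<Sum>s\<in>T. series_scale (\<gamma> s) s) \<in> sum_of_images \<Theta> (C0 a d abv R t)"
      unfolding hatB using fin \<beta>(1)
      by (intro exI[of _ "e ` basis"] exI[of _ "\<lambda>x. \<beta> (inv e x)"]) auto
  next
    fix T \<gamma> x
    assume T: "finite T \<and> T \<subseteq> hatB a d t \<and> \<gamma> ` T \<subseteq> R \<and>
        (\<Sum>s\<in>T. series_scale (\<gamma> s) s) \<in> sum_of_images \<Theta> (C0 a d abv R t)" and x: "x \<in> T"
    then obtain A where A: "A \<subseteq> basis" "T = e ` A" unfolding hatB by (auto simp: subset_image_iff)
    define \<beta> where "\<beta> v = (if v \<in> A then \<gamma> (e v) else 0)" for v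
    obtain g where g: "\<And>l. null (g l)"
      and "weighted \<beta> = weighted (\<lambda>w. \<Sum>l\<in>UNIV. D (\<lambda>u. of_int (u $ l)) (g l) w)"
      using T unfolding A(2) sum_e[OF A(1)] images \<beta>_def by blast
    hence eq: "\<beta> w = (\<Sum>l\<in>UNIV. D (\<lambda>u. of_int (u $ l)) (g l) w)" for w
      using t_0 by (auto simp: weighted_def fun_eq_iff)
    have "\<beta> w = 0" if "w \<notin> basis" for w
      using that A(1) by (auto simp: \<beta>_def)
    hence "\<beta> v = 0" for v
      by (rule independence[OF _ g eq])
    moreover obtain v where "v \<in> A" "x = e v" using x A(2) by blast
    ultimately show "\<gamma> x = 0" unfolding \<beta>_def by metis
  qed
qed

end

section \<open>Top cohomology of the Koszul complex\<close>

lemma basis_modulo_image: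
  fixes \<theta> :: "'m::ab_group_add \<Rightarrow> 'm'::ab_group_add"
  assumes basis: "basis_modulo R sc M N S"
    and inj: "inj \<theta>" and add: "\<And>x y. \<theta> (x + y) = \<theta> x + \<theta> y" and scale: "\<And>r x. \<theta> (sc r x) = sc' r (\<theta> x)"
  shows "basis_modulo R sc' (\<theta> ` M) (\<theta> ` N) (\<theta> ` S)"
proof -
  note gen = basis[unfolded basis_modulo_def, THEN conjunct2, THEN conjunct1, rule_format]
    and ind = basis[unfolded basis_modulo_def, THEN conjunct2, THEN conjunct2, rule_format]
  have zero: "\<theta> 0 = 0" using add[of 0 0] by simp
  have diff: "\<theta> (x - y) = \<theta> x - \<theta> y" for x y using add[of "x - y" y] by (simp add: algebra_simps)
  have sum: "(\<Sum>s\<in>\<theta> ` T. sc' (c s) s) = \<theta> (\<Sum>s\<in>T. sc (c (\<theta> s)) s)" for T c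
  proof -
    have "\<theta> (sum f A) = (\<Sum>s\<in>A. \<theta> (f s))" for f and A :: "'m set"
      by (induction A rule: infinite_finite_induct) (auto simp: zero add)
    thus ?thesis by (simp add: sum.reindex[OF inj_on_subset[OF inj]] scale)
  qed
  show ?thesis unfolding basis_modulo_def
  proof (intro conjI ballI allI impI)
    show "\<theta> ` S \<subseteq> \<theta> ` M" using basis by (auto simp: basis_modulo_def)
  next
    fix y assume "y \<in> \<theta> ` M"
    then obtain x where x: "x \<in> M" "y = \<theta> x" by blast
    obtain T c where T: "finite T" "T \<subseteq> S" "c ` T \<subseteq> R" "x - (\<Sum>s\<in>T. sc (c s) s) \<in> N"
      using gen[OF x(1)] by (elim exE conjE) rule
    have "y - (\<Sum>s\<in>\<theta> ` T. sc' (c (inv \<theta> s)) s) = \<theta> (x - (\<Sum>s\<in>T. sc (c s) s))"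
      by (simp add: sum x diff inv_f_f[OF inj])
    thus "\<exists>T c. finite T \<and> T \<subseteq> \<theta> ` S \<and> c ` T \<subseteq> R \<and> y - (\<Sum>s\<in>T. sc' (c s) s) \<in> \<theta> ` N"
      using T by (intro exI[of _ "\<theta> ` T"] exI[of _ "\<lambda>s. c (inv \<theta> s)"]) (auto simp: inv_f_f[OF inj])
  next
    fix T c s
    assume T: "finite T \<and> T \<subseteq> \<theta> ` S \<and> c ` T \<subseteq> R \<and> (\<Sum>s\<in>T. sc' (c s) s) \<in> \<theta> ` N" and s: "s \<in> T"
    then obtain A where A: "A \<subseteq> S" "T = \<theta> ` A" by (auto simp: subset_image_iff)
    have "finite A" using T A(2) finite_imageD inj_on_subset[OF inj] by blast
    moreover have "(\<lambda>s. c (\<theta> s)) ` A \<subseteq> R" using T A(2) by auto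
    moreover have "(\<Sum>s\<in>A. sc (c (\<theta> s)) s) \<in> N"
      using T inj unfolding A(2) sum by (auto simp: inj_image_mem_iff)
    ultimately have "c (\<theta> s) = 0" if "s \<in> A" for s
      using that A(1) by (intro ind[of A "\<lambda>s. c (\<theta> s)"]) auto
    thus "c s = 0" using s A(2) by blast
  qed
qed

lemma koszul_cocycles_top:
  fixes D :: "'n::{finite, linorder} \<Rightarrow> 'm::ab_group_add \<Rightarrow> 'm"
  assumes "\<And>l. D l 0 = 0"
  shows "koszul_cocycles D M CARD('n) = top_form ` M"
proof (intro equalityI subsetI)
  fix \<omega> assume "\<omega> \<in> koszul_cocycles D M CARD('n)"
  hence "\<omega> UNIV \<in> M" "\<And>J. card J \<noteq> CARD('n) \<Longrightarrow> \<omega> J = 0"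
    by (auto simp: koszul_cocycles_def koszul_forms_def)
  moreover have "\<omega> = top_form (\<omega> UNIV)"
  proof
    fix J :: "'n set"
    have "J = UNIV \<or> card J \<noteq> CARD('n)" using card_eq_UNIV_imp_eq_UNIV[of J] by auto
    thus "\<omega> J = top_form (\<omega> UNIV) J" using calculation(2) by (auto simp: top_form_def)
  qed
  ultimately show "\<omega> \<in> top_form ` M" by blast
next
  fix \<omega> :: "'n set \<Rightarrow> 'm" assume "\<omega> \<in> top_form ` M"
  then obtain f where f: "f \<in> M" "\<omega> = top_form f" by blast
  have "koszul_nabla D \<omega> = 0"
  proof
    fix J
    have "\<omega> (J - {l}) = 0" for l using f(2) by (auto simp: top_form_def)
    thus "koszul_nabla D \<omega> J = 0 J" by (simp add: koszul_nabla_def assms cong: if_cong)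
  qed
  thus "\<omega> \<in> koszul_cocycles D M CARD('n)"
    using f card_eq_UNIV_imp_eq_UNIV[where ?'a = 'n]
    by (auto simp: koszul_cocycles_def koszul_forms_def top_form_def)
qed

text \<open>A form of degree n-1 has one coefficient for each omitted index l. Since M is closed
  under negation, the signs of the boundary map can be absorbed into these coefficients.\<close>

lemma koszul_coboundaries_top:
  fixes D :: "'n::{finite, linorder} \<Rightarrow> 'm::ab_group_add \<Rightarrow> 'm"
  assumes D0: "\<And>l. D l 0 = 0" and Dm: "\<And>l x. D l (- x) = - D l x"
    and M: "\<And>x. x \<in> M \<Longrightarrow> - x \<in> M"
  shows "koszul_coboundaries D M CARD('n) = top_form ` sum_of_images D M"
proof -
  define \<epsilon> :: "'n \<Rightarrow> 'm \<Rightarrow> 'm" where "\<epsilon> l x = (if even (card {j\<in>UNIV. j < l}) then x else - x)" for l x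
  have \<epsilon>M: "\<epsilon> l x \<in> M" if "x \<in> M" for l x using that M by (simp add: \<epsilon>_def)
  have \<epsilon>D: "(if even (card {j\<in>UNIV. j < l}) then D l x else - D l x) = D l (\<epsilon> l x)" for l x
    by (simp add: \<epsilon>_def Dm)
  have \<epsilon>\<epsilon>: "\<epsilon> l (\<epsilon> l x) = x" for l x by (simp add: \<epsilon>_def)
  have n: "CARD('n) > 0" by simp
  have nabla: "koszul_nabla D \<omega> = top_form (\<Sum>l\<in>UNIV. D l (\<epsilon> l (\<omega> (UNIV - {l}))))"
    if \<omega>: "\<And>J. card J \<noteq> CARD('n) - 1 \<Longrightarrow> \<omega> J = 0" for \<omega>
  proof
    fix J :: "'n set"
    show "koszul_nabla D \<omega> J = top_form (\<Sum>l\<in>UNIV. D l (\<epsilon> l (\<omega> (UNIV - {l})))) J"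
    proof (cases "J = UNIV")
      case True
      thus ?thesis unfolding koszul_nabla_def top_form_def True \<epsilon>D by simp
    next
      case False
      hence J: "card J < CARD('n)" by (intro psubset_card_mono) auto
      have "\<omega> (J - {l}) = 0" if "l \<in> J" for l
      proof (rule \<omega>)
        have "card J > 0" using that by (auto simp: card_gt_0_iff)
        thus "card (J - {l}) \<noteq> CARD('n) - 1" using J that by (simp add: card_Diff_singleton)
      qed
      hence "koszul_nabla D \<omega> J = 0"
        unfolding koszul_nabla_def by (intro sum.neutral ballI) (simp add: D0 cong: if_cong)
      thus ?thesis using False by (simp add: top_form_def)
    qed
  qed
  have co: "card (UNIV - {l::'n}) = CARD('n) - 1" for l by (simp add: card_Diff_singleton)
  have "koszul_nabla D ` koszul_forms M (CARD('n) - 1) = top_form ` sum_of_images D M"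
  proof (intro equalityI subsetI)
    fix y assume "y \<in> koszul_nabla D ` koszul_forms M (CARD('n) - 1)"
    then obtain \<omega> where \<omega>: "\<And>J. card J = CARD('n) - 1 \<Longrightarrow> \<omega> J \<in> M"
        "\<And>J. card J \<noteq> CARD('n) - 1 \<Longrightarrow> \<omega> J = 0" "y = koszul_nabla D \<omega>"
      by (auto simp: koszul_forms_def)
    have "(\<Sum>l\<in>UNIV. D l (\<epsilon> l (\<omega> (UNIV - {l})))) \<in> sum_of_images D M"
      unfolding sum_of_images_def using \<epsilon>M[OF \<omega>(1)[OF co]]
      by (intro CollectI exI[of _ "\<lambda>l. \<epsilon> l (\<omega> (UNIV - {l}))"]) simp
    moreover have "y = top_form (\<Sum>l\<in>UNIV. D l (\<epsilon> l (\<omega> (UNIV - {l}))))"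
      unfolding \<omega>(3) by (rule nabla) (rule \<omega>(2))
    ultimately show "y \<in> top_form ` sum_of_images D M" by (rule rev_image_eqI)
  next
    fix y :: "'n set \<Rightarrow> 'm" assume "y \<in> top_form ` sum_of_images D M"
    then obtain g where g: "\<And>l. g l \<in> M" "y = top_form (\<Sum>l\<in>UNIV. D l (g l))"
      by (auto simp: sum_of_images_def)
    \<comment> \<open>For J of size n-1, \<open>the_elem (- J)\<close> is the one omitted
      index.\<close>
    define \<omega> where "\<omega> J = (if card J = CARD('n) - 1 then \<epsilon> (the_elem (- J)) (g (the_elem (- J))) else 0)" for J
    have "- (UNIV - {l}) = {l}" for l :: 'n by auto
    hence \<omega>: "\<omega> (UNIV - {l}) = \<epsilon> l (g l)" for l unfolding \<omega>_def co by simp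
    have "koszul_nabla D \<omega> = top_form (\<Sum>l\<in>UNIV. D l (\<epsilon> l (\<omega> (UNIV - {l}))))"
      by (rule nabla) (simp add: \<omega>_def)
    hence "koszul_nabla D \<omega> = y" unfolding \<omega> \<epsilon>\<epsilon> g(2) .
    moreover have "\<omega> \<in> koszul_forms M (CARD('n) - 1)"
      by (auto simp: koszul_forms_def \<omega>_def intro!: \<epsilon>M g)
    ultimately show "y \<in> koszul_nabla D ` koszul_forms M (CARD('n) - 1)" by blast
  qed
  thus ?thesis using n by (simp add: koszul_coboundaries_def)
qed

theorem theorem1p2:
  fixes p q s :: nat
    and a d :: "'n::{finite, linorder} \<Rightarrow> nat"
    and abv :: "'k::{alg_closed_field, field_char_0} \<Rightarrow> real"
    and Qq :: "'k set"
    and red :: "'k \<Rightarrow> 'f::{field, finite}"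
    and lam_bar :: 'f
    and lam zeta pi_el tpi :: 'k
    and R :: "'k set"
    and C :: "((int, 'n) vec \<Rightarrow> 'k) set"
    and D :: "'n \<Rightarrow> ((int, 'n) vec \<Rightarrow> 'k) \<Rightarrow> ((int, 'n) vec \<Rightarrow> 'k)"
  assumes "prime p" and "p > 2" and "s \<ge> 1" and "q = p ^ s" and "CARD('f) = q"
    and "\<And>i. a i > 0 \<and> \<not> p dvd a i"
    and "\<And>i. d i > 0 \<and> \<not> p dvd d i"
    and "padic_algebraic_closure p abv"
    and "unramified_extension abv s Qq"
    and "reduction_map abv Qq red"
    and "lam_bar \<noteq> 0"
    and "teichmuller_representative abv Qq red lam_bar lam"
    and "zeta ^ p = 1" and "zeta \<noteq> 1"
    and "pi_el ^ (p - 1) = - of_nat p"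
    and "tpi ^ estar a d = pi_el"
    and "R = integers_of abv (field_generated (Qq \<union> {zeta, tpi}))"
    and "C = C0 a d abv R tpi"
    and "D = opD a d pi_el lam"
  shows "basis_modulo R series_scale C (sum_of_images D C) (hatB a d tpi) \<and>
         basis_modulo R (form_scale series_scale)
           (koszul_cocycles D C CARD('n)) (koszul_coboundaries D C CARD('n))
           (top_form ` hatB a d tpi)"
proof -
  let ?K = "field_generated (Qq \<union> {zeta, tpi})" and ?Qp = "closure_of_rationals abv"
  have p0: "p > 0" using \<open>p > 2\<close> by simp
  have abv: "is_absolute_value abv" and abv_p: "abv (of_nat p) = 1 / real p"
    and Qp_complete: "complete_under abv ?Qp"
    and Qp_alg: "\<And>x. \<exists>f. f \<noteq> 0 \<and> (\<forall>i. coeff f i \<in> ?Qp) \<and> poly f x = 0"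
    using \<open>padic_algebraic_closure p abv\<close> unfolding padic_algebraic_closure_def by blast+
  interpret nonarch abv using abv by unfold_locales
  have Qp: "is_subfield ?Qp" by (rule closure_of_rationals_subfield[OF abv])
  obtain S where Qq: "is_subfield Qq" "?Qp \<subseteq> Qq" "finite S" "basis_modulo ?Qp (*) Qq {0} S"
    using \<open>unramified_extension abv s Qq\<close> unfolding unramified_extension_def by blast
  interpret exponents a d
    using assms(6,7) by unfold_locales auto
  have zeta: "zeta ^ p \<in> Qq" using \<open>zeta ^ p = 1\<close> is_subfieldD(2)[OF Qq(1)] by simp
  \<comment> \<open>The power of \<open>tpi\<close> with this exponent is -p. This makes
    \<open>tpi\<close> a radical over Q_q, and |p| < 1 yields |tpi| \<le> 1.\<close>
  let ?m = "estar a d * (p - 1)"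
  have m: "?m > 0" using estar_pos \<open>p > 2\<close> by simp
  have tpi_m: "tpi ^ ?m = - of_nat p"
    using \<open>tpi ^ estar a d = pi_el\<close> \<open>pi_el ^ (p - 1) = - of_nat p\<close> by (simp add: power_mult)
  hence tpi: "tpi ^ ?m \<in> Qq" using is_subfieldD(5,9)[OF Qq(1)] by simp
  have K: "is_subfield ?K" "Qq \<union> {zeta, tpi} \<subseteq> ?K"
    by (rule field_generated_subfield, rule field_generated_superset)
  have K_complete: "complete_under abv ?K"
    by (rule complete_field_generated[OF Qp Qp_complete Qp_alg Qq zeta p0 tpi m])
  have "abv tpi ^ ?m = 1 / real p"
    using abv_power[of tpi ?m] abv_p unfolding tpi_m by simp
  moreover have "1 < abv tpi ^ ?m" if "1 < abv tpi" using that m by (intro one_less_power)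
  ultimately have tpi_le: "abv tpi \<le> 1" using \<open>p > 2\<close> by (force simp: not_less[symmetric])
  have tpi_0: "tpi \<noteq> 0"
    using tpi_m m p0 by (auto simp: zero_power)
  have lam: "lam \<in> integers_of abv Qq" "red lam = lam_bar"
    using \<open>teichmuller_representative abv Qq red lam_bar lam\<close>
    unfolding teichmuller_representative_def by auto
  \<comment> \<open>A nonzero residue keeps \<open>lam\<close> out of the maximal ideal, so it is a
    unit.\<close>
  hence "\<not> abv lam < 1"
    using \<open>reduction_map abv Qq red\<close> \<open>lam_bar \<noteq> 0\<close> unfolding reduction_map_def by blast
  hence lam_unit: "abv lam = 1" and lam_K: "lam \<in> ?K"
    using lam(1) K(2) by (auto simp: integers_of_def)
  have unit: "abv (of_nat m) = 1" if "\<not> p dvd m" for m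
  proof (rule abv_of_nat_unit)
    show "abv (of_nat p) < 1" using \<open>p > 2\<close> by (simp add: abv_p)
    show "coprime m p" using prime_imp_coprime[OF \<open>prime p\<close> that] by (simp add: coprime_commute)
  qed
  interpret X: dwork_series a d abv ?K tpi lam
    using K K_complete tpi_le tpi_0 lam_K lam_unit unit assms(6,7) by unfold_locales auto
  have R: "R = X.R" by (rule assms(17))
  have D: "D = X.\<Theta>" using assms(16,19) by simp
  have C: "C = C0 a d abv X.R tpi" using assms(18) R by simp
  have basis: "basis_modulo R series_scale C (sum_of_images D C) (hatB a d tpi)"
    unfolding R C D by (rule X.basis_C0)
  have cocycles: "koszul_cocycles D C CARD('n) = top_form ` C"
    unfolding D by (rule koszul_cocycles_top) (rule X.opD_zero)
  have coboundaries: "koszul_coboundaries D C CARD('n) = top_form ` sum_of_images D C"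
    unfolding C D by (intro koszul_coboundaries_top X.opD_zero X.opD_minus X.C0_minus)
  have "basis_modulo R (form_scale series_scale)
      (top_form ` C :: ('n set \<Rightarrow> (int, 'n) vec \<Rightarrow> 'k) set) (top_form ` sum_of_images D C) (top_form ` hatB a d tpi)"
  proof (rule basis_modulo_image[OF basis])
    show "inj (top_form :: _ \<Rightarrow> 'n set \<Rightarrow> (int, 'n) vec \<Rightarrow> 'k)"
      by (rule injI) (metis top_form_def)
    show "top_form (x + y) = (top_form x + top_form y :: 'n set \<Rightarrow> (int, 'n) vec \<Rightarrow> 'k)" for x y
      by (auto simp: top_form_def fun_eq_iff)
    show "top_form (series_scale r x) = (form_scale series_scale r (top_form x) :: 'n set \<Rightarrow> (int, 'n) vec \<Rightarrow> 'k)"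
      for r x
      by (auto simp: top_form_def form_scale_def series_scale_def fun_eq_iff)
  qed
  thus ?thesis using basis cocycles coboundaries by simp
qed

end
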